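(* Let $\mathcal{T}$ be a triangulated category. Let $X\xrightarrow{u_i}Y_i\xrightarrow{v_i}Z_i\xrightarrow{w_i}\Sigma X$ for $i=1,2,3$ be exact triangles (with the same object $X$), and let $(1_X,g_1,h_1)$ be a good map of triangles from the first to the second and $(1_X,g_2,h_2)$ a good map of triangles from the second to the third. Then the candidate triangle $$Y_1\xrightarrow{\begin{bmatrix} g_2g_1 \\ v_1 \end{bmatrix}}Y_3\oplus Z_1\xrightarrow{\begin{bmatrix}v_3&-h_2h_1\end{bmatrix}}Z_3\xrightarrow{(\Sigma u_1)w_3}\Sigma Y_1$$ is replaceably exact.
   Context: $\mathcal{T}$ is a triangulated category with self-equivalence $\Sigma$. A candidate triangle is a diagram $X\xrightarrow{u}Y\xrightarrow{v}Z\xrightarrow{w}\Sigma X$ with $vu=0$, $wv=0$, $(\Sigma u)w=0$. "Exact triangle" or "triangle" means distinguished triangle. A map of triangles $(f,g,h)$ from $X\xrightarrow{u}Y\xrightarrow{v}Z\xrightarrow{w}\Sigma X$ to $X'\xrightarrow{u'}Y'\xrightarrow{v'}Z'\xrightarrow{w'}\Sigma X'$ consists of $f\colon X\to X'$, $g\colon Y\to Y'$, $h\colon Z\to Z'$ with $gu=u'f$, $hv=v'g$, $(\Sigma f)w=w'h$. The mapping cone of $(f,g,h)$ is the sequence $X'\oplus Y\to Y'\oplus Z\to Z'\oplus\Sigma X\to\Sigma X'\oplus\Sigma Y$ with successive maps $\begin{bmatrix}u'&g \\ 0&-v\end{bmatrix},\begin{bmatrix}v'&h \\ 0&-w\end{bmatrix},\begin{bmatrix}w'&\Sigma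 f \\ 0&-\Sigma u\end{bmatrix}$ (acting on column vectors). $(f,g,h)$ is good if its mapping cone is an exact triangle. In a candidate triangle $X\xrightarrow{u}Y\xrightarrow{v}Z\xrightarrow{w}\Sigma X$, the map $u$ is replaceable if there is a map $\hat u\colon X\to Y$ such that $X\xrightarrow{\hat u}Y\xrightarrow{v}Z\xrightarrow{w}\Sigma X$ is exact; replaceability of $v$ or of $w$ is defined similarly (replacing only that one map). The candidate triangle is replaceably exact if each of its three maps is replaceable. *)

theory Defs
  imports "HOL-Algebra.Group"
begin

section \<open>Categories\<close>

record ('o, 'm) category_data =
  obj :: "'o set"
  arr :: "'m set"
  Dom :: "'m \<Rightarrow> 'o"
  Cod :: "'m \<Rightarrow> 'o"
  ident :: "'o \<Rightarrow> 'm"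
  compose :: "'m \<Rightarrow> 'm \<Rightarrow> 'm" (infixl "\<cdot>\<index>" 70)

text \<open>Composition is in applicative order: \<open>g \<cdot> f\<close> is \<open>f\<close> followed by \<open>g\<close>.\<close>

context
  fixes C :: "('o, 'm, 'x) category_data_scheme" (structure)
begin

definition Hom :: "'o \<Rightarrow> 'o \<Rightarrow> 'm set" where
  "Hom X Y = {f \<in> arr C. Dom C f = X \<and> Cod C f = Y}"

definition iso_arrow :: "'m \<Rightarrow> bool" where
  "iso_arrow f \<longleftrightarrow> f \<in> arr C \<and>
     (\<exists>g \<in> Hom (Cod C f) (Dom C f). g \<cdot> f = ident C (Dom C f) \<and> f \<cdot> g = ident C (Cod C f))"

definition endofunctor :: "('o \<Rightarrow> 'o) \<Rightarrow> ('m \<Rightarrow> 'm) \<Rightarrow> bool" where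
  "endofunctor F\<^sub>o F\<^sub>a \<longleftrightarrow>
     (\<forall>X \<in> obj C. F\<^sub>o X \<in> obj C) \<and>
     (\<forall>X Y. \<forall>f \<in> Hom X Y. F\<^sub>a f \<in> Hom (F\<^sub>o X) (F\<^sub>o Y)) \<and>
     (\<forall>X \<in> obj C. F\<^sub>a (ident C X) = ident C (F\<^sub>o X)) \<and>
     (\<forall>X Y Z. \<forall>f \<in> Hom X Y. \<forall>g \<in> Hom Y Z. F\<^sub>a (g \<cdot> f) = F\<^sub>a g \<cdot> F\<^sub>a f)"

definition naturally_isomorphic ::
    "('o \<Rightarrow> 'o) \<Rightarrow> ('m \<Rightarrow> 'm) \<Rightarrow> ('o \<Rightarrow> 'o) \<Rightarrow> ('m \<Rightarrow> 'm) \<Rightarrow> bool" where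
  "naturally_isomorphic F\<^sub>o F\<^sub>a G\<^sub>o G\<^sub>a \<longleftrightarrow>
     (\<exists>\<eta>. (\<forall>X \<in> obj C. \<eta> X \<in> Hom (F\<^sub>o X) (G\<^sub>o X) \<and> iso_arrow (\<eta> X)) \<and>
          (\<forall>X Y. \<forall>f \<in> Hom X Y. \<eta> Y \<cdot> F\<^sub>a f = G\<^sub>a f \<cdot> \<eta> X))"

definition self_equivalence :: "('o \<Rightarrow> 'o) \<Rightarrow> ('m \<Rightarrow> 'm) \<Rightarrow> bool" where
  "self_equivalence F\<^sub>o F\<^sub>a \<longleftrightarrow> endofunctor F\<^sub>o F\<^sub>a \<and>
     (\<exists>G\<^sub>o G\<^sub>a. endofunctor G\<^sub>o G\<^sub>a \<and>
        naturally_isomorphic (\<lambda>X. G\<^sub>o (F\<^sub>o X)) (\<lambda>f. G\<^sub>a (F\<^sub>a f)) (\<lambda>X. X) (\<lambda>f. f) \<and>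
        naturally_isomorphic (\<lambda>X. F\<^sub>o (G\<^sub>o X)) (\<lambda>f. F\<^sub>a (G\<^sub>a f)) (\<lambda>X. X) (\<lambda>f. f))"

definition zero_object :: "'o \<Rightarrow> bool" where
  "zero_object N \<longleftrightarrow> N \<in> obj C \<and>
     (\<forall>X \<in> obj C. (\<exists>!f. f \<in> Hom X N) \<and> (\<exists>!f. f \<in> Hom N X))"

end

locale category =
  fixes C :: "('o, 'm, 'x) category_data_scheme" (structure)
  assumes Dom_obj: "f \<in> arr C \<Longrightarrow> Dom C f \<in> obj C"
    and Cod_obj: "f \<in> arr C \<Longrightarrow> Cod C f \<in> obj C"
    and ident_Hom: "X \<in> obj C \<Longrightarrow> ident C X \<in> Hom C X X"
    and compose_Hom: "f \<in> Hom C X Y \<Longrightarrow> g \<in> Hom C Y Z \<Longrightarrow> g \<cdot> f \<in> Hom C X Z"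
    and compose_ident_right: "f \<in> Hom C X Y \<Longrightarrow> f \<cdot> ident C X = f"
    and compose_ident_left: "f \<in> Hom C X Y \<Longrightarrow> ident C Y \<cdot> f = f"
    and compose_assoc:
      "f \<in> Hom C W X \<Longrightarrow> g \<in> Hom C X Y \<Longrightarrow> h \<in> Hom C Y Z \<Longrightarrow> h \<cdot> (g \<cdot> f) = (h \<cdot> g) \<cdot> f"


section \<open>Additive categories\<close>

text \<open>A choice of binary biproducts \<open>A \<oplus> B\<close>, with injections and projections, is carried as
  part of the data; it exists in any additive category and is not constrained further.\<close>

record ('o, 'm) additive_data = "('o, 'm) category_data" +
  plus_arr :: "'m \<Rightarrow> 'm \<Rightarrow> 'm" (infixl "\<boxplus>\<index>" 65)
  zero_arr :: "'o \<Rightarrow> 'o \<Rightarrow> 'm"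
  bisum :: "'o \<Rightarrow> 'o \<Rightarrow> 'o"
  in1 :: "'o \<Rightarrow> 'o \<Rightarrow> 'm"
  in2 :: "'o \<Rightarrow> 'o \<Rightarrow> 'm"
  pr1 :: "'o \<Rightarrow> 'o \<Rightarrow> 'm"
  pr2 :: "'o \<Rightarrow> 'o \<Rightarrow> 'm"

context
  fixes A :: "('o, 'm, 'x) additive_data_scheme" (structure)
begin

definition Hom_group :: "'o \<Rightarrow> 'o \<Rightarrow> 'm monoid" where
  "Hom_group X Y = \<lparr>carrier = Hom A X Y, monoid.mult = plus_arr A, one = zero_arr A X Y\<rparr>"

definition neg :: "'m \<Rightarrow> 'm" where
  "neg f = m_inv (Hom_group (Dom A f) (Cod A f)) f"

text \<open>Matrices act on columns: \<open>col_mat f g\<close> is the map with components \<open>f\<close>, \<open>g\<close> into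
  \<open>Cod f \<oplus> Cod g\<close>; \<open>row_mat f g\<close> is the map with components \<open>f\<close>, \<open>g\<close> out of
  \<open>Dom f \<oplus> Dom g\<close>; \<open>mat22 a b c d\<close> has first row \<open>a b\<close> and second row \<open>c d\<close>.\<close>

definition col_mat :: "'m \<Rightarrow> 'm \<Rightarrow> 'm" where
  "col_mat f g = in1 A (Cod A f) (Cod A g) \<cdot> f \<boxplus> in2 A (Cod A f) (Cod A g) \<cdot> g"

definition row_mat :: "'m \<Rightarrow> 'm \<Rightarrow> 'm" where
  "row_mat f g = f \<cdot> pr1 A (Dom A f) (Dom A g) \<boxplus> g \<cdot> pr2 A (Dom A f) (Dom A g)"

definition mat22 :: "'m \<Rightarrow> 'm \<Rightarrow> 'm \<Rightarrow> 'm \<Rightarrow> 'm" where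
  "mat22 a b c d = col_mat (row_mat a b) (row_mat c d)"

end

locale additive_category = category A
  for A :: "('o, 'm, 'x) additive_data_scheme" (structure) +
  assumes Hom_comm_group: "X \<in> obj A \<Longrightarrow> Y \<in> obj A \<Longrightarrow> comm_group (Hom_group A X Y)"
    and compose_plus_right:
      "f \<in> Hom A X Y \<Longrightarrow> f' \<in> Hom A X Y \<Longrightarrow> g \<in> Hom A Y Z \<Longrightarrow>
        g \<cdot> (f \<boxplus> f') = g \<cdot> f \<boxplus> g \<cdot> f'"
    and compose_plus_left:
      "f \<in> Hom A X Y \<Longrightarrow> g \<in> Hom A Y Z \<Longrightarrow> g' \<in> Hom A Y Z \<Longrightarrow>
        (g \<boxplus> g') \<cdot> f = g \<cdot> f \<boxplus> g' \<cdot> f"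
    and ex_zero_object: "\<exists>N. zero_object A N"
    and bisum_obj: "X \<in> obj A \<Longrightarrow> Y \<in> obj A \<Longrightarrow> bisum A X Y \<in> obj A"
    and in1_Hom: "X \<in> obj A \<Longrightarrow> Y \<in> obj A \<Longrightarrow> in1 A X Y \<in> Hom A X (bisum A X Y)"
    and in2_Hom: "X \<in> obj A \<Longrightarrow> Y \<in> obj A \<Longrightarrow> in2 A X Y \<in> Hom A Y (bisum A X Y)"
    and pr1_Hom: "X \<in> obj A \<Longrightarrow> Y \<in> obj A \<Longrightarrow> pr1 A X Y \<in> Hom A (bisum A X Y) X"
    and pr2_Hom: "X \<in> obj A \<Longrightarrow> Y \<in> obj A \<Longrightarrow> pr2 A X Y \<in> Hom A (bisum A X Y) Y"
    and pr1_in1: "X \<in> obj A \<Longrightarrow> Y \<in> obj A \<Longrightarrow> pr1 A X Y \<cdot> in1 A X Y = ident A X"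
    and pr2_in2: "X \<in> obj A \<Longrightarrow> Y \<in> obj A \<Longrightarrow> pr2 A X Y \<cdot> in2 A X Y = ident A Y"
    and pr1_in2: "X \<in> obj A \<Longrightarrow> Y \<in> obj A \<Longrightarrow> pr1 A X Y \<cdot> in2 A X Y = zero_arr A Y X"
    and pr2_in1: "X \<in> obj A \<Longrightarrow> Y \<in> obj A \<Longrightarrow> pr2 A X Y \<cdot> in1 A X Y = zero_arr A X Y"
    and in_pr_sum: "X \<in> obj A \<Longrightarrow> Y \<in> obj A \<Longrightarrow>
        in1 A X Y \<cdot> pr1 A X Y \<boxplus> in2 A X Y \<cdot> pr2 A X Y = ident A (bisum A X Y)"


section \<open>Triangulated categories\<close>

text \<open>A diagram \<open>X \<rightarrow> Y \<rightarrow> Z \<rightarrow> \<Sigma>X\<close> is encoded by its three maps \<open>(u, v, w)\<close>; the objects are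
  recovered as domains and codomains (\<open>X\<close> as the domain of \<open>u\<close>, since \<open>\<Sigma>\<close> need not be
  injective on objects).\<close>

record ('o, 'm) triangulated_data = "('o, 'm) additive_data" +
  shift_obj :: "'o \<Rightarrow> 'o"
  shift_arr :: "'m \<Rightarrow> 'm"
  distinguished :: "('m \<times> 'm \<times> 'm) set"

context
  fixes T :: "('o, 'm, 'x) triangulated_data_scheme" (structure)
begin

definition triangle_diagram :: "'o \<Rightarrow> 'o \<Rightarrow> 'o \<Rightarrow> 'm \<Rightarrow> 'm \<Rightarrow> 'm \<Rightarrow> bool" where
  "triangle_diagram X Y Z u v w \<longleftrightarrow>
     u \<in> Hom T X Y \<and> v \<in> Hom T Y Z \<and> w \<in> Hom T Z (shift_obj T X)"

definition candidate_triangle :: "'o \<Rightarrow> 'o \<Rightarrow> 'o \<Rightarrow> 'm \<Rightarrow> 'm \<Rightarrow> 'm \<Rightarrow> bool" where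
  "candidate_triangle X Y Z u v w \<longleftrightarrow> triangle_diagram X Y Z u v w \<and>
     v \<cdot> u = zero_arr T X Z \<and>
     w \<cdot> v = zero_arr T Y (shift_obj T X) \<and>
     shift_arr T u \<cdot> w = zero_arr T Z (shift_obj T Y)"

definition exact_triangle :: "'o \<Rightarrow> 'o \<Rightarrow> 'o \<Rightarrow> 'm \<Rightarrow> 'm \<Rightarrow> 'm \<Rightarrow> bool" where
  "exact_triangle X Y Z u v w \<longleftrightarrow>
     candidate_triangle X Y Z u v w \<and> (u, v, w) \<in> distinguished T"

fun triangle_map :: "'m \<times> 'm \<times> 'm \<Rightarrow> 'm \<times> 'm \<times> 'm \<Rightarrow> 'm \<times> 'm \<times> 'm \<Rightarrow> bool" where
  "triangle_map (f, g, h) (u, v, w) (u', v', w') \<longleftrightarrow>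
     f \<in> Hom T (Dom T u) (Dom T u') \<and>
     g \<in> Hom T (Dom T v) (Dom T v') \<and>
     h \<in> Hom T (Dom T w) (Dom T w') \<and>
     g \<cdot> u = u' \<cdot> f \<and> h \<cdot> v = v' \<cdot> g \<and> shift_arr T f \<cdot> w = w' \<cdot> h"

text \<open>The canonical map \<open>\<Sigma>A \<oplus> \<Sigma>B \<rightarrow> \<Sigma>(A \<oplus> B)\<close>, by which the last term
  \<open>\<Sigma>X' \<oplus> \<Sigma>Y\<close> of a mapping cone is identified with the shift of its first term.\<close>

definition shift_bisum :: "'o \<Rightarrow> 'o \<Rightarrow> 'm" where
  "shift_bisum A B = row_mat T (shift_arr T (in1 T A B)) (shift_arr T (in2 T A B))"

fun mapping_cone ::
    "'m \<times> 'm \<times> 'm \<Rightarrow> 'm \<times> 'm \<times> 'm \<Rightarrow> 'm \<times> 'm \<times> 'm \<Rightarrow> 'm \<times> 'm \<times> 'm" where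
  "mapping_cone (f, g, h) (u, v, w) (u', v', w') =
     (mat22 T u' g (zero_arr T (Dom T u') (Cod T v)) (neg T v),
      mat22 T v' h (zero_arr T (Dom T v') (Cod T w)) (neg T w),
      shift_bisum (Dom T u') (Cod T u) \<cdot>
        mat22 T w' (shift_arr T f)
          (zero_arr T (Dom T w') (shift_obj T (Cod T u))) (neg T (shift_arr T u)))"

definition good_map :: "'m \<times> 'm \<times> 'm \<Rightarrow> 'm \<times> 'm \<times> 'm \<Rightarrow> 'm \<times> 'm \<times> 'm \<Rightarrow> bool" where
  "good_map \<phi> t t' \<longleftrightarrow> triangle_map \<phi> t t' \<and> mapping_cone \<phi> t t' \<in> distinguished T"

definition replaceable1 :: "'o \<Rightarrow> 'o \<Rightarrow> 'o \<Rightarrow> 'm \<Rightarrow> 'm \<Rightarrow> 'm \<Rightarrow> bool" where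
  "replaceable1 X Y Z u v w \<longleftrightarrow> (\<exists>u'. exact_triangle X Y Z u' v w)"

definition replaceable2 :: "'o \<Rightarrow> 'o \<Rightarrow> 'o \<Rightarrow> 'm \<Rightarrow> 'm \<Rightarrow> 'm \<Rightarrow> bool" where
  "replaceable2 X Y Z u v w \<longleftrightarrow> (\<exists>v'. exact_triangle X Y Z u v' w)"

definition replaceable3 :: "'o \<Rightarrow> 'o \<Rightarrow> 'o \<Rightarrow> 'm \<Rightarrow> 'm \<Rightarrow> 'm \<Rightarrow> bool" where
  "replaceable3 X Y Z u v w \<longleftrightarrow> (\<exists>w'. exact_triangle X Y Z u v w')"

definition replaceably_exact :: "'o \<Rightarrow> 'o \<Rightarrow> 'o \<Rightarrow> 'm \<Rightarrow> 'm \<Rightarrow> 'm \<Rightarrow> bool" where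
  "replaceably_exact X Y Z u v w \<longleftrightarrow> candidate_triangle X Y Z u v w \<and>
     replaceable1 X Y Z u v w \<and> replaceable2 X Y Z u v w \<and> replaceable3 X Y Z u v w"

end

text \<open>Verdier's axioms; \<open>TR4\<close> is the octahedral axiom.\<close>

locale triangulated_category = additive_category T
  for T :: "('o, 'm, 'x) triangulated_data_scheme" (structure) +
  assumes shift_equivalence: "self_equivalence T (shift_obj T) (shift_arr T)"
    and shift_additive: "f \<in> Hom T X Y \<Longrightarrow> f' \<in> Hom T X Y \<Longrightarrow>
        shift_arr T (f \<boxplus> f') = shift_arr T f \<boxplus> shift_arr T f'"
    and distinguished_candidate:
      "(u, v, w) \<in> distinguished T \<Longrightarrow>
        candidate_triangle T (Dom T u) (Cod T u) (Cod T v) u v w"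
    and TR1_iso:
      "exact_triangle T X Y Z u v w \<Longrightarrow> triangle_diagram T X' Y' Z' u' v' w' \<Longrightarrow>
        triangle_map T (f, g, h) (u, v, w) (u', v', w') \<Longrightarrow>
        iso_arrow T f \<Longrightarrow> iso_arrow T g \<Longrightarrow> iso_arrow T h \<Longrightarrow>
        exact_triangle T X' Y' Z' u' v' w'"
    and TR1_ident:
      "X \<in> obj T \<Longrightarrow> zero_object T N \<Longrightarrow>
        exact_triangle T X X N (ident T X) (zero_arr T X N) (zero_arr T N (shift_obj T X))"
    and TR1_cone:
      "u \<in> Hom T X Y \<Longrightarrow> \<exists>Z v w. exact_triangle T X Y Z u v w"
    and TR2:
      "triangle_diagram T X Y Z u v w \<Longrightarrow>
        exact_triangle T X Y Z u v w \<longleftrightarrow>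
        exact_triangle T Y Z (shift_obj T X) v w (neg T (shift_arr T u))"
    and TR3:
      "exact_triangle T X Y Z u v w \<Longrightarrow> exact_triangle T X' Y' Z' u' v' w' \<Longrightarrow>
        f \<in> Hom T X X' \<Longrightarrow> g \<in> Hom T Y Y' \<Longrightarrow> g \<cdot> u = u' \<cdot> f \<Longrightarrow>
        \<exists>h. triangle_map T (f, g, h) (u, v, w) (u', v', w')"
    and TR4:
      "exact_triangle T X Y A f f' f'' \<Longrightarrow>
        exact_triangle T Y Z C g g' g'' \<Longrightarrow>
        exact_triangle T X Z B (g \<cdot> f) k' k'' \<Longrightarrow>
        \<exists>a b. exact_triangle T A B C a b (shift_arr T f' \<cdot> g'') \<and>
          a \<cdot> f' = k' \<cdot> g \<and> k'' \<cdot> a = f'' \<and> b \<cdot> k' = g' \<and> g'' \<cdot> b = shift_arr T f \<cdot> k''"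

end

theory Submission
  imports Defs
begin

text \<open>A map \<open>(1, g, h)\<close> is good iff its square is homotopy cartesian with differential \<open>(\<Sigma>u) w'\<close>. Homotopy
  cartesian squares paste, by the octahedral axiom, but with an uncontrolled differential: this
  replaces the third map. For the other two, the octahedral axiom completes \<open>g = g\<^sub>2 g\<^sub>1\<close> to a square with
  some \<open>h'\<close> and the prescribed differential, which replaces the second map. As \<open>w\<^sub>3 (h\<^sub>2 h\<^sub>1 - h') = 0\<close>, the
  difference factors as \<open>v\<^sub>3 t\<close>, and shearing \<open>Y\<^sub>3 \<oplus> Z\<^sub>1\<close> by \<open>t\<close> moves the change into the first map.\<close>

section \<open>Additive categories\<close>

text \<open>Completion and pasting are one configuration, isolated in
  \<open>octahedron_split\<close>: a composite \<open>g f\<close> lands in one summand of a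
  biproduct as a map \<open>c\<close>, and the projection of \<open>g\<close> to the other summand
  is the second map of the triangle on \<open>f\<close>. The result relates the differential
  \<open>g''\<close> of the triangle on \<open>g\<close> to the differential \<open>\<omega>\<close>
  of the triangle on \<open>c\<close> by \<open>g'' \<beta> = (\<Sigma>f) \<omega>\<close>, with
  \<open>\<beta>\<close> invertible. In completion the unknown triangle is the one on
  \<open>g\<close>, so this equation determines its differential. In pasting the unknown triangle is
  the one on \<open>c\<close>, and the equation describes its differential only after composition
  with \<open>\<Sigma>f\<close>; that is where control is lost.

  A second obstacle is that cones are unique only up to a non-unique isomorphism, so sums and
  retracts of exact triangles have no universal property to rest on. Each is compared with a
  triangle supplied by TR1, and the comparison map is shown to be invertible.\<close>

lemma Hom_iff: "f \<in> Hom C X Y \<longleftrightarrow> f \<in> arr C \<and> Dom C f = X \<and> Cod C f = Y"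
  by (simp add: Hom_def)

context category
begin

declare Dom_obj [simp] Cod_obj [simp]

lemma ident_arr [simp]:
  assumes "X \<in> obj C"
  shows "ident C X \<in> arr C" "Dom C (ident C X) = X" "Cod C (ident C X) = X"
  using ident_Hom[OF assms] by (auto simp: Hom_iff)

lemma compose_arr [simp]:
  assumes "f \<in> arr C" "g \<in> arr C" "Dom C g = Cod C f"
  shows "g \<cdot> f \<in> arr C" "Dom C (g \<cdot> f) = Dom C f" "Cod C (g \<cdot> f) = Cod C g"
  using compose_Hom[of f "Dom C f" "Cod C f" g "Cod C g"] assms by (auto simp: Hom_iff)

lemma ident_compose [simp]: "f \<in> arr C \<Longrightarrow> Cod C f = Y \<Longrightarrow> ident C Y \<cdot> f = f"
  using compose_ident_left by (auto simp: Hom_iff)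

lemma compose_ident [simp]: "f \<in> arr C \<Longrightarrow> Dom C f = X \<Longrightarrow> f \<cdot> ident C X = f"
  using compose_ident_right by (auto simp: Hom_iff)

lemma compose_assoc_right [simp]:
  assumes "f \<in> arr C" "g \<in> arr C" "h \<in> arr C" "Dom C g = Cod C f" "Dom C h = Cod C g"
  shows "(h \<cdot> g) \<cdot> f = h \<cdot> (g \<cdot> f)"
  using compose_assoc[of f "Dom C f" "Cod C f" g "Cod C g" h "Cod C h"] assms by (auto simp: Hom_iff)

text \<open>Composites are kept associated to the right, so an equation for
  \<open>a \<cdot> b\<close> has to be applied in front of a tail \<open>x\<close>.\<close>

lemma compose_rewrite:
  assumes "a \<cdot> b = c" "a \<in> arr C" "b \<in> arr C" "Dom C a = Cod C b"
    and "x \<in> arr C" "Cod C x = Dom C b"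
  shows "a \<cdot> (b \<cdot> x) = c \<cdot> x"
  using assms compose_assoc_right[of x b a] by simp

lemma iso_arrow_ident: "X \<in> obj C \<Longrightarrow> iso_arrow C (ident C X)"
  unfolding iso_arrow_def by (auto simp: Hom_iff)

lemma iso_arrowI:
  assumes "f \<in> Hom C X Y" "g \<in> Hom C Y X" "g \<cdot> f = ident C X" "f \<cdot> g = ident C Y"
  shows "iso_arrow C f"
  using assms unfolding iso_arrow_def by (auto simp: Hom_iff)

lemma iso_arrowE:
  assumes "iso_arrow C f" "f \<in> Hom C X Y"
  obtains g where "g \<in> Hom C Y X" "g \<cdot> f = ident C X" "f \<cdot> g = ident C Y"
  using assms unfolding iso_arrow_def by (auto simp: Hom_iff)

end

context additive_category
begin

section \<open>Arithmetic of the Hom groups and bilinearity of composition\<close>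

lemma zero_arr_arr [simp]:
  assumes "X \<in> obj A" "Y \<in> obj A"
  shows "zero_arr A X Y \<in> arr A" "Dom A (zero_arr A X Y) = X" "Cod A (zero_arr A X Y) = Y"
  using monoid.one_closed[OF comm_monoid.axioms(1)[OF comm_group.axioms(1)[OF Hom_comm_group[OF assms]]]]
  by (auto simp: Hom_group_def Hom_iff)

lemma Hom_group_simps:
  "carrier (Hom_group A X Y) = Hom A X Y"
  "monoid.mult (Hom_group A X Y) f g = f \<boxplus> g"
  "one (Hom_group A X Y) = zero_arr A X Y"
  by (simp_all add: Hom_group_def)

lemma Hom_group_of:
  assumes "f \<in> arr A"
  shows "comm_group (Hom_group A (Dom A f) (Cod A f))"
  using assms by (simp add: Hom_comm_group)

lemma plus_arr_arr [simp]:
  assumes "f \<in> arr A" "g \<in> arr A" "Dom A g = Dom A f" "Cod A g = Cod A f"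
  shows "f \<boxplus> g \<in> arr A" "Dom A (f \<boxplus> g) = Dom A f" "Cod A (f \<boxplus> g) = Cod A f"
proof -
  interpret G: comm_group "Hom_group A (Dom A f) (Cod A f)"
    by (rule Hom_group_of[OF assms(1)])
  show "f \<boxplus> g \<in> arr A" "Dom A (f \<boxplus> g) = Dom A f" "Cod A (f \<boxplus> g) = Cod A f"
    using G.m_closed[of f g] assms by (auto simp: Hom_group_simps Hom_iff)
qed

lemma neg_arr [simp]:
  assumes "f \<in> arr A"
  shows "neg A f \<in> arr A" "Dom A (neg A f) = Dom A f" "Cod A (neg A f) = Cod A f"
proof -
  interpret G: comm_group "Hom_group A (Dom A f) (Cod A f)"
    by (rule Hom_group_of[OF assms(1)])
  show "neg A f \<in> arr A" "Dom A (neg A f) = Dom A f" "Cod A (neg A f) = Cod A f"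
    using G.inv_closed[of f] assms by (auto simp: neg_def Hom_group_simps Hom_iff)
qed

lemma plus_assoc [simp]:
  assumes "f \<in> arr A" "g \<in> arr A" "h \<in> arr A" "Dom A g = Dom A f" "Cod A g = Cod A f"
    "Dom A h = Dom A f" "Cod A h = Cod A f"
  shows "(f \<boxplus> g) \<boxplus> h = f \<boxplus> (g \<boxplus> h)"
proof -
  interpret G: comm_group "Hom_group A (Dom A f) (Cod A f)"
    by (rule Hom_group_of[OF assms(1)])
  show ?thesis using G.m_assoc[of f g h] assms by (auto simp: Hom_group_simps Hom_iff)
qed

lemma plus_commute:
  assumes "f \<in> arr A" "g \<in> arr A" "Dom A g = Dom A f" "Cod A g = Cod A f"
  shows "f \<boxplus> g = g \<boxplus> f"
proof -
  interpret G: comm_group "Hom_group A (Dom A f) (Cod A f)"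
    by (rule Hom_group_of[OF assms(1)])
  show ?thesis using G.m_comm[of f g] assms by (auto simp: Hom_group_simps Hom_iff)
qed

lemma plus_left_commute:
  assumes "f \<in> arr A" "g \<in> arr A" "h \<in> arr A" "Dom A g = Dom A f" "Cod A g = Cod A f"
    "Dom A h = Dom A f" "Cod A h = Cod A f"
  shows "f \<boxplus> (g \<boxplus> h) = g \<boxplus> (f \<boxplus> h)"
  using assms plus_assoc[of f g h] plus_assoc[of g f h] plus_commute[of f g] by simp

lemma zero_plus [simp]:
  assumes "f \<in> arr A" "Dom A f = X" "Cod A f = Y"
  shows "zero_arr A X Y \<boxplus> f = f" "f \<boxplus> zero_arr A X Y = f"
proof -
  interpret G: comm_group "Hom_group A (Dom A f) (Cod A f)"
    by (rule Hom_group_of[OF assms(1)])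
  show "zero_arr A X Y \<boxplus> f = f" "f \<boxplus> zero_arr A X Y = f"
    using G.l_one[of f] G.r_one[of f] assms by (auto simp: Hom_group_simps Hom_iff)
qed

lemma plus_neg [simp]:
  assumes "f \<in> arr A"
  shows "neg A f \<boxplus> f = zero_arr A (Dom A f) (Cod A f)" "f \<boxplus> neg A f = zero_arr A (Dom A f) (Cod A f)"
proof -
  interpret G: comm_group "Hom_group A (Dom A f) (Cod A f)"
    by (rule Hom_group_of[OF assms(1)])
  show "neg A f \<boxplus> f = zero_arr A (Dom A f) (Cod A f)" "f \<boxplus> neg A f = zero_arr A (Dom A f) (Cod A f)"
    using G.l_inv[of f] G.r_inv[of f] assms by (auto simp: neg_def Hom_group_simps Hom_iff)
qed

lemma plus_neg_cancel [simp]: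
  assumes "f \<in> arr A" "g \<in> arr A" "Dom A g = Dom A f" "Cod A g = Cod A f"
  shows "neg A f \<boxplus> (f \<boxplus> g) = g" "f \<boxplus> (neg A f \<boxplus> g) = g"
  using plus_assoc[of "neg A f" f g] plus_assoc[of f "neg A f" g] assms by simp_all

lemma neg_unique:
  assumes "f \<in> arr A" "g \<in> arr A" "Dom A g = Dom A f" "Cod A g = Cod A f"
    and "f \<boxplus> g = zero_arr A (Dom A f) (Cod A f)"
  shows "neg A f = g"
  using plus_neg_cancel(1)[OF assms(1-4)] assms by simp

lemma eq_if_plus_neg_zero:
  assumes "f \<in> arr A" "g \<in> arr A" "Dom A g = Dom A f" "Cod A g = Cod A f"
    and "f \<boxplus> neg A g = zero_arr A (Dom A f) (Cod A f)"
  shows "f = g"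
  using plus_assoc[of f "neg A g" g] assms by simp

lemma neg_neg [simp]: "f \<in> arr A \<Longrightarrow> neg A (neg A f) = f"
  by (rule neg_unique) simp_all

lemma neg_inject: "neg A f = neg A g \<Longrightarrow> f \<in> arr A \<Longrightarrow> g \<in> arr A \<Longrightarrow> f = g"
  using neg_neg by metis

lemma neg_zero [simp]: "X \<in> obj A \<Longrightarrow> Y \<in> obj A \<Longrightarrow> neg A (zero_arr A X Y) = zero_arr A X Y"
  by (rule neg_unique) simp_all

lemma neg_plus [simp]:
  assumes "f \<in> arr A" "g \<in> arr A" "Dom A g = Dom A f" "Cod A g = Cod A f"
  shows "neg A (f \<boxplus> g) = neg A f \<boxplus> neg A g"
proof (rule neg_unique)
  have "g \<boxplus> (neg A f \<boxplus> neg A g) = neg A f"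
    using assms plus_left_commute[of g "neg A f" "neg A g"] by simp
  then show "f \<boxplus> g \<boxplus> (neg A f \<boxplus> neg A g) = zero_arr A (Dom A (f \<boxplus> g)) (Cod A (f \<boxplus> g))"
    using assms by simp
qed (use assms in simp_all)

lemma compose_plus [simp]:
  assumes "f \<in> arr A" "f' \<in> arr A" "g \<in> arr A" "Dom A f' = Dom A f" "Cod A f' = Cod A f"
    "Dom A g = Cod A f"
  shows "g \<cdot> (f \<boxplus> f') = g \<cdot> f \<boxplus> g \<cdot> f'"
  using assms compose_plus_right[of f "Dom A f" "Cod A f" f' g "Cod A g"] by (simp add: Hom_iff)

lemma plus_compose [simp]:
  assumes "f \<in> arr A" "g \<in> arr A" "g' \<in> arr A" "Dom A g' = Dom A g" "Cod A g' = Cod A g"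
    "Dom A g = Cod A f"
  shows "(g \<boxplus> g') \<cdot> f = g \<cdot> f \<boxplus> g' \<cdot> f"
  using assms compose_plus_left[of f "Dom A f" "Cod A f" g "Cod A g" g'] by (simp add: Hom_iff)

lemma zero_if_idem:
  assumes "f \<in> arr A" "f \<boxplus> f = f"
  shows "f = zero_arr A (Dom A f) (Cod A f)"
  using plus_neg_cancel(1)[of f f] assms by simp

lemma compose_zero [simp]:
  assumes "g \<in> arr A" "X \<in> obj A" "Dom A g = Y"
  shows "g \<cdot> zero_arr A X Y = zero_arr A X (Cod A g)"
proof -
  have Y: "Y \<in> obj A" using assms by auto
  have "zero_arr A X Y \<boxplus> zero_arr A X Y = zero_arr A X Y" using assms Y by simp
  then have "g \<cdot> zero_arr A X Y \<boxplus> g \<cdot> zero_arr A X Y = g \<cdot> zero_arr A X Y"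
    using assms Y compose_plus[of "zero_arr A X Y" "zero_arr A X Y" g] by simp
  from zero_if_idem[OF _ this] show ?thesis using assms Y by simp
qed

lemma zero_compose [simp]:
  assumes "f \<in> arr A" "Z \<in> obj A" "Cod A f = Y"
  shows "zero_arr A Y Z \<cdot> f = zero_arr A (Dom A f) Z"
proof -
  have Y: "Y \<in> obj A" using assms by auto
  have "zero_arr A Y Z \<boxplus> zero_arr A Y Z = zero_arr A Y Z" using assms Y by simp
  then have "zero_arr A Y Z \<cdot> f \<boxplus> zero_arr A Y Z \<cdot> f = zero_arr A Y Z \<cdot> f"
    using assms Y plus_compose[of f "zero_arr A Y Z" "zero_arr A Y Z"] by simp
  from zero_if_idem[OF _ this] show ?thesis using assms Y by simp
qed

lemma compose_neg [simp]:
  assumes "f \<in> arr A" "g \<in> arr A" "Dom A g = Cod A f"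
  shows "g \<cdot> neg A f = neg A (g \<cdot> f)"
  by (rule sym, rule neg_unique) (use assms compose_plus[of f "neg A f" g] in simp_all)

lemma neg_compose [simp]:
  assumes "f \<in> arr A" "g \<in> arr A" "Dom A g = Cod A f"
  shows "neg A g \<cdot> f = neg A (g \<cdot> f)"
  by (rule sym, rule neg_unique) (use assms plus_compose[of f g "neg A g"] in simp_all)

section \<open>Zero objects and biproducts\<close>

lemma zero_objectD:
  assumes "zero_object A N"
  shows "N \<in> obj A" "f \<in> Hom A X N \<Longrightarrow> f = zero_arr A X N"
proof -
  show N: "N \<in> obj A" using assms by (simp add: zero_object_def)
  show "f = zero_arr A X N" if f: "f \<in> Hom A X N"
  proof -
    have X: "X \<in> obj A" using f by (auto simp: Hom_iff)
    then have "\<exists>!f. f \<in> Hom A X N" using assms by (simp add: zero_object_def)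
    moreover have "zero_arr A X N \<in> Hom A X N" using X N by (simp add: Hom_iff)
    ultimately show ?thesis using f by blast
  qed
qed

text \<open>This criterion is an equation between arrows, which an additive functor transports; that
  is how \<open>\<Sigma>\<close> of a zero object is recognised as zero.\<close>

lemma zero_objectI:
  assumes N: "N \<in> obj A" and "ident A N = zero_arr A N N"
  shows "zero_object A N"
proof -
  have 1: "f = zero_arr A X N" if "f \<in> Hom A X N" for f X
  proof -
    have "f = ident A N \<cdot> f" using that by (simp add: Hom_iff)
    also have "\<dots> = zero_arr A N N \<cdot> f" by (simp only: assms(2))
    also have "\<dots> = zero_arr A X N" using that N by (simp add: Hom_iff)
    finally show ?thesis .
  qed
  have 2: "f = zero_arr A N X" if "f \<in> Hom A N X" for f X
  proof -
    have "f = f \<cdot> ident A N" using that by (simp add: Hom_iff)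
    also have "\<dots> = f \<cdot> zero_arr A N N" by (simp only: assms(2))
    also have "\<dots> = zero_arr A N X" using that N by (simp add: Hom_iff)
    finally show ?thesis .
  qed
  show ?thesis unfolding zero_object_def
  proof (intro conjI ballI N)
    fix X assume X: "X \<in> obj A"
    show "\<exists>!f. f \<in> Hom A X N"
      by (rule ex1I[of _ "zero_arr A X N"]) (use X N 1 in \<open>auto simp: Hom_iff\<close>)
    show "\<exists>!f. f \<in> Hom A N X"
      by (rule ex1I[of _ "zero_arr A N X"]) (use X N 2 in \<open>auto simp: Hom_iff\<close>)
  qed
qed

text \<open>Arbitrary biproduct data, beyond the chosen \<open>bisum\<close>: pasting decomposes
  \<open>(Y3 \<oplus> Z2) \<oplus> Z1\<close> along the graph of a map, which is no chosen
  sum.\<close>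

definition biprod :: "'o \<Rightarrow> 'o \<Rightarrow> 'o \<Rightarrow> 'm \<Rightarrow> 'm \<Rightarrow> 'm \<Rightarrow> 'm \<Rightarrow> bool" where
  "biprod P X Y i j p q \<longleftrightarrow> i \<in> Hom A X P \<and> j \<in> Hom A Y P \<and> p \<in> Hom A P X \<and> q \<in> Hom A P Y \<and>
     p \<cdot> i = ident A X \<and> q \<cdot> j = ident A Y \<and> p \<cdot> j = zero_arr A Y X \<and> q \<cdot> i = zero_arr A X Y \<and>
     i \<cdot> p \<boxplus> j \<cdot> q = ident A P"

lemma biprod_bisum:
  assumes "X \<in> obj A" "Y \<in> obj A"
  shows "biprod (bisum A X Y) X Y (in1 A X Y) (in2 A X Y) (pr1 A X Y) (pr2 A X Y)"
  using assms by (simp add: biprod_def in1_Hom in2_Hom pr1_Hom pr2_Hom pr1_in1 pr2_in2 pr1_in2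
      pr2_in1 in_pr_sum)

lemma biprodD:
  assumes "biprod P X Y i j p q"
  shows "P \<in> obj A" "X \<in> obj A" "Y \<in> obj A"
    "i \<in> arr A" "Dom A i = X" "Cod A i = P" "j \<in> arr A" "Dom A j = Y" "Cod A j = P"
    "p \<in> arr A" "Dom A p = P" "Cod A p = X" "q \<in> arr A" "Dom A q = P" "Cod A q = Y"
    "p \<cdot> i = ident A X" "q \<cdot> j = ident A Y" "p \<cdot> j = zero_arr A Y X" "q \<cdot> i = zero_arr A X Y"
    "x \<in> arr A \<Longrightarrow> Cod A x = X \<Longrightarrow> p \<cdot> (i \<cdot> x) = x"
    "y \<in> arr A \<Longrightarrow> Cod A y = Y \<Longrightarrow> q \<cdot> (j \<cdot> y) = y"
    "y \<in> arr A \<Longrightarrow> Cod A y = Y \<Longrightarrow> p \<cdot> (j \<cdot> y) = zero_arr A (Dom A y) X"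
    "x \<in> arr A \<Longrightarrow> Cod A x = X \<Longrightarrow> q \<cdot> (i \<cdot> x) = zero_arr A (Dom A x) Y"
proof -
  note a = assms[unfolded biprod_def Hom_iff]
  show o: "P \<in> obj A" "X \<in> obj A" "Y \<in> obj A" using a by auto
  show "i \<in> arr A" "Dom A i = X" "Cod A i = P" "j \<in> arr A" "Dom A j = Y" "Cod A j = P"
    "p \<in> arr A" "Dom A p = P" "Cod A p = X" "q \<in> arr A" "Dom A q = P" "Cod A q = Y"
    "p \<cdot> i = ident A X" "q \<cdot> j = ident A Y" "p \<cdot> j = zero_arr A Y X" "q \<cdot> i = zero_arr A X Y"
    using a by simp_all
  show "x \<in> arr A \<Longrightarrow> Cod A x = X \<Longrightarrow> p \<cdot> (i \<cdot> x) = x"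
    using a by (simp add: compose_rewrite[of p i])
  show "y \<in> arr A \<Longrightarrow> Cod A y = Y \<Longrightarrow> q \<cdot> (j \<cdot> y) = y"
    using a by (simp add: compose_rewrite[of q j])
  show "y \<in> arr A \<Longrightarrow> Cod A y = Y \<Longrightarrow> p \<cdot> (j \<cdot> y) = zero_arr A (Dom A y) X"
    using a o by (simp add: compose_rewrite[of p j])
  show "x \<in> arr A \<Longrightarrow> Cod A x = X \<Longrightarrow> q \<cdot> (i \<cdot> x) = zero_arr A (Dom A x) Y"
    using a o by (simp add: compose_rewrite[of q i])
qed

lemma biprod_sum: "biprod P X Y i j p q \<Longrightarrow> i \<cdot> p \<boxplus> j \<cdot> q = ident A P"
  by (simp add: biprod_def)

lemma biprod_eq_from:
  assumes "biprod P X Y i j p q" "f \<in> arr A" "g \<in> arr A" "Dom A f = P" "Dom A g = P"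
    "Cod A f = Cod A g" "f \<cdot> i = g \<cdot> i" "f \<cdot> j = g \<cdot> j"
  shows "f = g"
proof -
  note b [simp] = biprodD[OF assms(1)]
  note s = biprod_sum[OF assms(1)]
  have *: "f = (f \<cdot> i) \<cdot> p \<boxplus> (f \<cdot> j) \<cdot> q" if "f \<in> arr A" "Dom A f = P" for f
  proof -
    have "f = f \<cdot> (i \<cdot> p \<boxplus> j \<cdot> q)" using that by (simp only: s) simp
    also have "\<dots> = (f \<cdot> i) \<cdot> p \<boxplus> (f \<cdot> j) \<cdot> q" using that by simp
    finally show ?thesis .
  qed
  show ?thesis using *[of f] *[of g] assms by metis
qed

lemma biprod_eq_to:
  assumes "biprod P X Y i j p q" "f \<in> arr A" "g \<in> arr A" "Cod A f = P" "Cod A g = P"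
    "Dom A f = Dom A g" "p \<cdot> f = p \<cdot> g" "q \<cdot> f = q \<cdot> g"
  shows "f = g"
proof -
  note b [simp] = biprodD[OF assms(1)]
  note s = biprod_sum[OF assms(1)]
  have *: "f = i \<cdot> (p \<cdot> f) \<boxplus> j \<cdot> (q \<cdot> f)" if "f \<in> arr A" "Cod A f = P" for f
  proof -
    have "f = (i \<cdot> p \<boxplus> j \<cdot> q) \<cdot> f" using that by (simp only: s) simp
    also have "\<dots> = i \<cdot> (p \<cdot> f) \<boxplus> j \<cdot> (q \<cdot> f)" using that by simp
    finally show ?thesis .
  qed
  show ?thesis using *[of f] *[of g] assms by metis
qed

lemma bisum_simps [simp]:
  assumes "X \<in> obj A" "Y \<in> obj A"
  shows "bisum A X Y \<in> obj A"
    "in1 A X Y \<in> arr A" "Dom A (in1 A X Y) = X" "Cod A (in1 A X Y) = bisum A X Y"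
    "in2 A X Y \<in> arr A" "Dom A (in2 A X Y) = Y" "Cod A (in2 A X Y) = bisum A X Y"
    "pr1 A X Y \<in> arr A" "Dom A (pr1 A X Y) = bisum A X Y" "Cod A (pr1 A X Y) = X"
    "pr2 A X Y \<in> arr A" "Dom A (pr2 A X Y) = bisum A X Y" "Cod A (pr2 A X Y) = Y"
    "pr1 A X Y \<cdot> in1 A X Y = ident A X" "pr2 A X Y \<cdot> in2 A X Y = ident A Y"
    "pr1 A X Y \<cdot> in2 A X Y = zero_arr A Y X" "pr2 A X Y \<cdot> in1 A X Y = zero_arr A X Y"
    "x \<in> arr A \<Longrightarrow> Cod A x = X \<Longrightarrow> pr1 A X Y \<cdot> (in1 A X Y \<cdot> x) = x"
    "y \<in> arr A \<Longrightarrow> Cod A y = Y \<Longrightarrow> pr2 A X Y \<cdot> (in2 A X Y \<cdot> y) = y"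
    "y \<in> arr A \<Longrightarrow> Cod A y = Y \<Longrightarrow> pr1 A X Y \<cdot> (in2 A X Y \<cdot> y) = zero_arr A (Dom A y) X"
    "x \<in> arr A \<Longrightarrow> Cod A x = X \<Longrightarrow> pr2 A X Y \<cdot> (in1 A X Y \<cdot> x) = zero_arr A (Dom A x) Y"
  using biprodD[OF biprod_bisum[OF assms]] by simp_all

lemmas bisum_eq_from = biprod_eq_from[OF biprod_bisum]

end


section \<open>Exactness in triangulated categories\<close>

context category
begin

section \<open>Fullness and faithfulness of a self-equivalence\<close>

lemma iso_cancel_right:
  assumes "iso_arrow C e" "e \<in> Hom C W X" "f \<in> Hom C X Y" "g \<in> Hom C X Y" "f \<cdot> e = g \<cdot> e"
  shows "f = g"
proof -
  obtain d where d: "d \<in> Hom C X W" "e \<cdot> d = ident C X"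
    using iso_arrowE[OF assms(1,2)] by metis
  have "(f \<cdot> e) \<cdot> d = (g \<cdot> e) \<cdot> d" by (simp only: assms(5))
  then show ?thesis using assms(2-4) d by (simp add: Hom_iff)
qed

lemma naturally_isomorphic_identityE:
  assumes "naturally_isomorphic C H Ha (\<lambda>X. X) (\<lambda>f. f)"
  obtains \<eta> where "\<And>X. X \<in> obj C \<Longrightarrow> \<eta> X \<in> Hom C (H X) X" "\<And>X. X \<in> obj C \<Longrightarrow> iso_arrow C (\<eta> X)"
    "\<And>X Y f. f \<in> Hom C X Y \<Longrightarrow> \<eta> Y \<cdot> Ha f = f \<cdot> \<eta> X"
proof -
  obtain \<eta> where "(\<forall>X \<in> obj C. \<eta> X \<in> Hom C (H X) X \<and> iso_arrow C (\<eta> X)) \<and>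
      (\<forall>X Y. \<forall>f \<in> Hom C X Y. \<eta> Y \<cdot> Ha f = f \<cdot> \<eta> X)"
    using assms unfolding naturally_isomorphic_def by blast
  then show ?thesis by (intro that[of \<eta>]) simp_all
qed

text \<open>Naturality reads \<open>f \<cdot> \<eta> X = \<eta> Y \<cdot> Ha f\<close>, so
  \<open>Ha f\<close> determines the left side, and \<open>\<eta> X\<close> cancels.\<close>

lemma naturally_isomorphic_identity_faithful:
  assumes "naturally_isomorphic C H Ha (\<lambda>X. X) (\<lambda>f. f)"
    and "f \<in> Hom C X Y" "g \<in> Hom C X Y" "Ha f = Ha g"
  shows "f = g"
proof -
  obtain \<eta> where \<eta>: "\<And>X. X \<in> obj C \<Longrightarrow> \<eta> X \<in> Hom C (H X) X" "\<And>X. X \<in> obj C \<Longrightarrow> iso_arrow C (\<eta> X)"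
    and n: "\<And>X Y f. f \<in> Hom C X Y \<Longrightarrow> \<eta> Y \<cdot> Ha f = f \<cdot> \<eta> X"
    using naturally_isomorphic_identityE[OF assms(1)] by metis
  have X: "X \<in> obj C" using assms(2) by (auto simp: Hom_iff)
  have "f \<cdot> \<eta> X = g \<cdot> \<eta> X" using n[OF assms(2)] n[OF assms(3)] assms(4) by simp
  then show ?thesis using iso_cancel_right[OF \<eta>(2)[OF X] \<eta>(1)[OF X]] assms(2,3) by blast
qed

text \<open>Conjugating \<open>Ga h\<close> by the isomorphism from \<open>G F\<close> to the
  identity gives a candidate \<open>f\<close>. Naturality then yields only
  \<open>Ga (Fa f) = Ga h\<close>; the isomorphism from \<open>F G\<close> to the identity makes
  \<open>Ga\<close> faithful and removes it.\<close>

lemma self_equivalence_full: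
  assumes eq: "self_equivalence C Fo Fa" and XY: "X \<in> obj C" "Y \<in> obj C"
    and h: "h \<in> Hom C (Fo X) (Fo Y)"
  shows "\<exists>f \<in> Hom C X Y. Fa f = h"
proof -
  obtain Go Ga where F: "endofunctor C Fo Fa" and G: "endofunctor C Go Ga"
    and GF: "naturally_isomorphic C (\<lambda>X. Go (Fo X)) (\<lambda>f. Ga (Fa f)) (\<lambda>X. X) (\<lambda>f. f)"
    and FG: "naturally_isomorphic C (\<lambda>X. Fo (Go X)) (\<lambda>f. Fa (Ga f)) (\<lambda>X. X) (\<lambda>f. f)"
    using eq unfolding self_equivalence_def by blast
  obtain \<eta> where \<eta>: "\<And>X. X \<in> obj C \<Longrightarrow> \<eta> X \<in> Hom C (Go (Fo X)) X"
    and i: "\<And>X. X \<in> obj C \<Longrightarrow> iso_arrow C (\<eta> X)"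
    and n: "\<And>X Y f. f \<in> Hom C X Y \<Longrightarrow> \<eta> Y \<cdot> Ga (Fa f) = f \<cdot> \<eta> X"
    using naturally_isomorphic_identityE[OF GF] by metis
  obtain x where x: "x \<in> Hom C X (Go (Fo X))" "x \<cdot> \<eta> X = ident C (Go (Fo X))"
    using iso_arrowE[OF i \<eta>] XY(1) by metis
  obtain y where y: "y \<in> Hom C Y (Go (Fo Y))" "y \<cdot> \<eta> Y = ident C (Go (Fo Y))"
    using iso_arrowE[OF i \<eta>] XY(2) by metis
  have Gh: "Ga h \<in> Hom C (Go (Fo X)) (Go (Fo Y))" using G h unfolding endofunctor_def by blast
  note t = Gh[unfolded Hom_iff] x(1)[unfolded Hom_iff] y(1)[unfolded Hom_iff]
    \<eta>[OF XY(1), unfolded Hom_iff] \<eta>[OF XY(2), unfolded Hom_iff]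
  define f where "f = \<eta> Y \<cdot> (Ga h \<cdot> x)"
  have f: "f \<in> Hom C X Y" using t by (simp add: f_def Hom_iff)
  have Ff: "Fa f \<in> Hom C (Fo X) (Fo Y)" using F f unfolding endofunctor_def by blast
  then have GFf: "Ga (Fa f) \<in> Hom C (Go (Fo X)) (Go (Fo Y))" using G unfolding endofunctor_def by blast
  note t' = GFf[unfolded Hom_iff]
  have "\<eta> Y \<cdot> Ga (Fa f) = \<eta> Y \<cdot> Ga h"
    using n[OF f] t x(2) by (simp add: f_def)
  then have "y \<cdot> (\<eta> Y \<cdot> Ga (Fa f)) = y \<cdot> (\<eta> Y \<cdot> Ga h)" by simp
  then have "Ga (Fa f) = Ga h"
    using t t' compose_rewrite[OF y(2)] by simp
  then have "Fa f = h" using naturally_isomorphic_identity_faithful[OF FG Ff h] by simp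
  then show ?thesis using f by blast
qed

end

context triangulated_category
begin

section \<open>The shift as an additive, full and faithful functor\<close>

lemma shift_endofunctor: "endofunctor T (shift_obj T) (shift_arr T)"
  using shift_equivalence by (simp add: self_equivalence_def)

lemma shift_obj_obj [simp]: "X \<in> obj T \<Longrightarrow> shift_obj T X \<in> obj T"
  using shift_endofunctor by (simp add: endofunctor_def)

lemma shift_arr_arr [simp]:
  assumes "f \<in> arr T"
  shows "shift_arr T f \<in> arr T" "Dom T (shift_arr T f) = shift_obj T (Dom T f)"
    "Cod T (shift_arr T f) = shift_obj T (Cod T f)"
proof -
  have "f \<in> Hom T (Dom T f) (Cod T f)" using assms by (simp add: Hom_iff)
  then have "shift_arr T f \<in> Hom T (shift_obj T (Dom T f)) (shift_obj T (Cod T f))"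
    using shift_endofunctor unfolding endofunctor_def by blast
  then show "shift_arr T f \<in> arr T" "Dom T (shift_arr T f) = shift_obj T (Dom T f)"
    "Cod T (shift_arr T f) = shift_obj T (Cod T f)" by (auto simp: Hom_iff)
qed

lemma shift_ident [simp]: "X \<in> obj T \<Longrightarrow> shift_arr T (ident T X) = ident T (shift_obj T X)"
  using shift_endofunctor by (simp add: endofunctor_def)

lemma shift_compose [simp]:
  assumes "f \<in> arr T" "g \<in> arr T" "Dom T g = Cod T f"
  shows "shift_arr T (g \<cdot> f) = shift_arr T g \<cdot> shift_arr T f"
proof -
  have "f \<in> Hom T (Dom T f) (Cod T f)" "g \<in> Hom T (Cod T f) (Cod T g)"
    using assms by (simp_all add: Hom_iff)
  then show ?thesis using shift_endofunctor unfolding endofunctor_def by blast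
qed

lemma shift_compose_eq:
  assumes "g \<cdot> f = h" "f \<in> arr T" "g \<in> arr T" "Dom T g = Cod T f"
  shows "shift_arr T g \<cdot> shift_arr T f = shift_arr T h"
  using assms shift_compose[of f g] by simp

lemma shift_plus [simp]:
  assumes "f \<in> arr T" "g \<in> arr T" "Dom T g = Dom T f" "Cod T g = Cod T f"
  shows "shift_arr T (f \<boxplus> g) = shift_arr T f \<boxplus> shift_arr T g"
  using assms by (intro shift_additive[of f "Dom T f" "Cod T f"]) (simp_all add: Hom_iff)

lemma shift_zero [simp]:
  assumes "X \<in> obj T" "Y \<in> obj T"
  shows "shift_arr T (zero_arr T X Y) = zero_arr T (shift_obj T X) (shift_obj T Y)"
  using zero_if_idem[of "shift_arr T (zero_arr T X Y)"] shift_plus[of "zero_arr T X Y" "zero_arr T X Y"]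
    assms by simp

lemma shift_neg [simp]:
  assumes "f \<in> arr T"
  shows "shift_arr T (neg T f) = neg T (shift_arr T f)"
  by (rule sym, rule neg_unique) (use assms shift_plus[of f "neg T f"] in simp_all)

lemma shift_faithful:
  assumes "f \<in> Hom T X Y" "g \<in> Hom T X Y" "shift_arr T f = shift_arr T g"
  shows "f = g"
proof -
  obtain Go Ga where
    "naturally_isomorphic T (\<lambda>X. Go (shift_obj T X)) (\<lambda>f. Ga (shift_arr T f)) (\<lambda>X. X) (\<lambda>f. f)"
    using shift_equivalence unfolding self_equivalence_def by blast
  from naturally_isomorphic_identity_faithful[OF this assms(1,2)] assms(3) show ?thesis by simp
qed

section \<open>Rotation and the weak universal properties of exact triangles\<close>

lemma exact_triangleD:
  assumes "exact_triangle T X Y Z u v w"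
  shows "X \<in> obj T" "Y \<in> obj T" "Z \<in> obj T"
    "u \<in> arr T" "Dom T u = X" "Cod T u = Y"
    "v \<in> arr T" "Dom T v = Y" "Cod T v = Z"
    "w \<in> arr T" "Dom T w = Z" "Cod T w = shift_obj T X"
    "v \<cdot> u = zero_arr T X Z" "w \<cdot> v = zero_arr T Y (shift_obj T X)"
    "shift_arr T u \<cdot> w = zero_arr T Z (shift_obj T Y)"
    "x \<in> arr T \<Longrightarrow> Cod T x = X \<Longrightarrow> v \<cdot> (u \<cdot> x) = zero_arr T (Dom T x) Z"
    "y \<in> arr T \<Longrightarrow> Cod T y = Y \<Longrightarrow> w \<cdot> (v \<cdot> y) = zero_arr T (Dom T y) (shift_obj T X)"
    "z \<in> arr T \<Longrightarrow> Cod T z = Z \<Longrightarrow>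
      shift_arr T u \<cdot> (w \<cdot> z) = zero_arr T (Dom T z) (shift_obj T Y)"
proof -
  note a = assms[unfolded exact_triangle_def candidate_triangle_def triangle_diagram_def Hom_iff]
  show o: "X \<in> obj T" "Y \<in> obj T" "Z \<in> obj T" using a by auto
  show "u \<in> arr T" "Dom T u = X" "Cod T u = Y"
    "v \<in> arr T" "Dom T v = Y" "Cod T v = Z"
    "w \<in> arr T" "Dom T w = Z" "Cod T w = shift_obj T X"
    "v \<cdot> u = zero_arr T X Z" "w \<cdot> v = zero_arr T Y (shift_obj T X)"
    "shift_arr T u \<cdot> w = zero_arr T Z (shift_obj T Y)" using a by auto
  show "x \<in> arr T \<Longrightarrow> Cod T x = X \<Longrightarrow> v \<cdot> (u \<cdot> x) = zero_arr T (Dom T x) Z"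
    using a o by (simp add: compose_rewrite[of v u])
  show "y \<in> arr T \<Longrightarrow> Cod T y = Y \<Longrightarrow> w \<cdot> (v \<cdot> y) = zero_arr T (Dom T y) (shift_obj T X)"
    using a o by (simp add: compose_rewrite[of w v])
  show "z \<in> arr T \<Longrightarrow> Cod T z = Z \<Longrightarrow>
      shift_arr T u \<cdot> (w \<cdot> z) = zero_arr T (Dom T z) (shift_obj T Y)"
    using a o by (simp add: compose_rewrite[of "shift_arr T u" w])
qed

lemma exact_rotate:
  assumes "exact_triangle T X Y Z u v w"
  shows "exact_triangle T Y Z (shift_obj T X) v w (neg T (shift_arr T u))"
  using TR2[of X Y Z u v w] assms by (simp add: exact_triangle_def candidate_triangle_def)

lemma zero_object_shift:
  assumes "zero_object T N"
  shows "zero_object T (shift_obj T N)"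
proof (rule zero_objectI)
  have N: "N \<in> obj T" using zero_objectD(1)[OF assms] .
  have "ident T N = zero_arr T N N" using zero_objectD(2)[OF assms ident_Hom[OF N]] .
  then show "ident T (shift_obj T N) = zero_arr T (shift_obj T N) (shift_obj T N)"
    using shift_ident[OF N] shift_zero[OF N N] by simp
  show "shift_obj T N \<in> obj T" using N by simp
qed

text \<open>TR1 offers the identity triangle with the zero object in third place. Applied with
  \<open>\<Sigma>N\<close> as that zero object, it is the rotation of the triangle wanted here, and
  TR2 is read backwards.\<close>

lemma exact_zero_ident:
  assumes "zero_object T N" "B \<in> obj T"
  shows "exact_triangle T N B B (zero_arr T N B) (ident T B) (zero_arr T B (shift_obj T N))"
proof -
  have N: "N \<in> obj T" using zero_objectD(1)[OF assms(1)] .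
  have "exact_triangle T B B (shift_obj T N) (ident T B) (zero_arr T B (shift_obj T N))
      (neg T (shift_arr T (zero_arr T N B)))"
    using TR1_ident[OF assms(2) zero_object_shift[OF assms(1)]] N assms(2) by simp
  then show ?thesis
    using TR2[of N B B "zero_arr T N B" "ident T B" "zero_arr T B (shift_obj T N)"] N assms(2)
    by (simp add: triangle_diagram_def Hom_iff)
qed

text \<open>A map \<open>f\<close> that kills \<open>u\<close> is the second component of a map of
  triangles to \<open>N \<rightarrow> B \<rightarrow> B\<close>; the third component supplied by TR3
  is the factor.\<close>

lemma exact_factor1:
  assumes e: "exact_triangle T X Y Z u v w" and f: "f \<in> Hom T Y B" "f \<cdot> u = zero_arr T X B"
  obtains g where "g \<in> Hom T Z B" "f = g \<cdot> v"
proof -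
  note [simp] = exact_triangleD[OF e]
  obtain N where N: "zero_object T N" using ex_zero_object by blast
  have [simp]: "N \<in> obj T" "B \<in> obj T" using zero_objectD(1)[OF N] f by (auto simp: Hom_iff)
  obtain h where "triangle_map T (zero_arr T X N, f, h) (u, v, w)
      (zero_arr T N B, ident T B, zero_arr T B (shift_obj T N))"
    using TR3[OF e exact_zero_ident[OF N, of B], of "zero_arr T X N" f] f
    by (auto simp: Hom_iff)
  then show ?thesis using f that[of h] by (auto simp: Hom_iff)
qed

lemma exact_factor2:
  assumes e: "exact_triangle T X Y Z u v w" and f: "f \<in> Hom T Z B" "f \<cdot> v = zero_arr T Y B"
  obtains g where "g \<in> Hom T (shift_obj T X) B" "f = g \<cdot> w"
  using exact_factor1[OF exact_rotate[OF e] f] .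

lemma exact_factor3:
  assumes e: "exact_triangle T X Y Z u v w"
    and f: "f \<in> Hom T (shift_obj T X) B" "f \<cdot> w = zero_arr T Z B"
  obtains g where "g \<in> Hom T (shift_obj T Y) B" "f = g \<cdot> shift_arr T u"
proof -
  note [simp] = exact_triangleD[OF e]
  obtain g where g: "g \<in> Hom T (shift_obj T Y) B" "f = g \<cdot> neg T (shift_arr T u)"
    using exact_factor2[OF exact_rotate[OF e] f] .
  then show ?thesis using that[of "neg T g"] by (simp add: Hom_iff)
qed

text \<open>Lifting on the other side runs \<open>TR3\<close> backwards, which needs \<open>\<Sigma>\<close> to be full and faithful.\<close>

lemma exact_lift:
  assumes e: "exact_triangle T X Y Z u v w" and f: "f \<in> Hom T B Z" "w \<cdot> f = zero_arr T B (shift_obj T X)"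
  obtains g where "g \<in> Hom T B Y" "f = v \<cdot> g"
proof -
  note [simp] = exact_triangleD[OF e]
  obtain N where N: "zero_object T N" using ex_zero_object by blast
  have [simp]: "N \<in> obj T" "B \<in> obj T" using zero_objectD(1)[OF N] f by (auto simp: Hom_iff)
  \<comment> \<open>TR3 only ever produces a third component. Rotating the identity triangle of
    \<open>B\<close> once and the given triangle twice puts the shift of the wanted lift there. Both
    last maps acquire a sign, so the signs cancel.\<close>
  note e' = exact_rotate[OF TR1_ident[OF \<open>B \<in> obj T\<close> N]]
  obtain s where s: "triangle_map T (f, zero_arr T N (shift_obj T X), s)
      (zero_arr T B N, zero_arr T N (shift_obj T B), neg T (shift_arr T (ident T B)))
      (w, neg T (shift_arr T u), neg T (shift_arr T v))"
    using TR3[OF e' exact_rotate[OF exact_rotate[OF e]], of f "zero_arr T N (shift_obj T X)"] f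
    by (auto simp: Hom_iff)
  have [simp]: "f \<in> arr T" "Dom T f = B" "Cod T f = Z" using f(1) by (simp_all add: Hom_iff)
  have s1: "s \<in> Hom T (shift_obj T B) (shift_obj T Y)" using s by (simp add: Hom_iff)
  then have [simp]: "s \<in> arr T" "Dom T s = shift_obj T B" "Cod T s = shift_obj T Y"
    by (simp_all add: Hom_iff)
  have s2: "shift_arr T f = shift_arr T v \<cdot> s"
    by (rule neg_inject) (use s in simp_all)
  obtain g where g: "g \<in> Hom T B Y" "shift_arr T g = s"
    using self_equivalence_full[OF shift_equivalence, of B Y s] s1 by auto
  then have [simp]: "g \<in> arr T" "Dom T g = B" "Cod T g = Y" by (simp_all add: Hom_iff)
  have "f = v \<cdot> g" by (rule shift_faithful[of _ B Z]) (simp_all add: Hom_iff s2 g(2))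
  with g show ?thesis using that by blast
qed

section \<open>Exactness under isomorphism, comparison and retracts\<close>

lemma exact_change3:
  assumes e: "exact_triangle T X Y Z u v w" and k: "iso_arrow T k" "k \<in> Hom T Z' Z"
    and "v' \<in> Hom T Y Z'" "k \<cdot> v' = v" "w \<cdot> k = w'"
  shows "exact_triangle T X Y Z' u v' w'"
proof -
  note [simp] = exact_triangleD[OF e]
  obtain l where l: "l \<in> Hom T Z Z'" "l \<cdot> k = ident T Z'" "k \<cdot> l = ident T Z"
    using iso_arrowE[OF k] .
  have il: "iso_arrow T l" using iso_arrowI[OF l(1) k(2) l(3) l(2)] .
  have [simp]: "k \<in> arr T" "Dom T k = Z'" "Cod T k = Z" "v' \<in> arr T" "Dom T v' = Y" "Cod T v' = Z'"
    "l \<in> arr T" "Dom T l = Z" "Cod T l = Z'"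
    using k l assms(4) by (auto simp: Hom_iff)
  have w': "w' \<in> Hom T Z' (shift_obj T X)" using assms(6) by (auto simp: Hom_iff)
  have "l \<cdot> v = (l \<cdot> k) \<cdot> v'" using assms(5) by simp
  also have "\<dots> = v'" by (simp only: l(2)) simp
  finally have 1: "l \<cdot> v = v'" .
  have 2: "w' \<cdot> l = w" unfolding assms(6)[symmetric] by (simp add: l(3))
  have m: "triangle_map T (ident T X, ident T Y, l) (u, v, w) (u, v', w')"
    using w' by (simp add: 1 2 Hom_iff)
  show ?thesis
    by (rule TR1_iso[OF e _ m])
      (use w' il in \<open>simp_all add: iso_arrow_ident triangle_diagram_def Hom_iff\<close>)
qed

lemma exact_change2:
  assumes e: "exact_triangle T X Y Z u v w" and k: "iso_arrow T k" "k \<in> Hom T Y Y'"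
    and "v' \<in> Hom T Y' Z" "v' \<cdot> k = v" "k \<cdot> u = u'"
  shows "exact_triangle T X Y' Z u' v' w"
proof -
  note [simp] = exact_triangleD[OF e]
  have [simp]: "k \<in> arr T" "Dom T k = Y" "Cod T k = Y'" "v' \<in> arr T" "Dom T v' = Y'" "Cod T v' = Z"
    using k assms(4) by (auto simp: Hom_iff)
  have u': "u' \<in> Hom T X Y'" using assms(6) by (auto simp: Hom_iff)
  then have m: "triangle_map T (ident T X, k, ident T Z) (u, v, w) (u', v', w)"
    by (simp add: Hom_iff assms(5,6))
  show ?thesis
    by (rule TR1_iso[OF e _ m])
      (use u' k in \<open>simp_all add: iso_arrow_ident triangle_diagram_def Hom_iff\<close>)
qed

text \<open>The five lemma for the functors \<open>Hom(-, B)\<close>.\<close>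

lemma exact_if_comparison:
  assumes e: "exact_triangle T X Y W u v0 w0" and c: "candidate_triangle T X Y Z u v w"
    and k: "k \<in> Hom T W Z" "k \<cdot> v0 = v" "w \<cdot> k = w0"
    and ex1: "\<And>B f. f \<in> Hom T Y B \<Longrightarrow> f \<cdot> u = zero_arr T X B \<Longrightarrow> \<exists>g \<in> Hom T Z B. f = g \<cdot> v"
    and ex2: "\<And>B f. f \<in> Hom T Z B \<Longrightarrow> f \<cdot> v = zero_arr T Y B \<Longrightarrow>
      \<exists>g \<in> Hom T (shift_obj T X) B. f = g \<cdot> w"
  shows "exact_triangle T X Y Z u v w"
proof -
  note [simp] = exact_triangleD[OF e]
  note c' = c[unfolded candidate_triangle_def triangle_diagram_def Hom_iff]
  have [simp]: "Z \<in> obj T" using c' Cod_obj[of v] by simp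
  have [simp]: "v \<in> arr T" "Dom T v = Y" "Cod T v = Z"
    "w \<in> arr T" "Dom T w = Z" "Cod T w = shift_obj T X"
    "v \<cdot> u = zero_arr T X Z" "w \<cdot> v = zero_arr T Y (shift_obj T X)"
    "shift_arr T u \<cdot> w = zero_arr T Z (shift_obj T Y)" using c' by simp_all
  have [simp]: "k \<in> arr T" "Dom T k = W" "Cod T k = Z" using k by (auto simp: Hom_iff)
  \<comment> \<open>That is, \<open>k\<close> is an epimorphism. If \<open>f k = 0\<close> then
    \<open>f v = f k v0 = 0\<close>, so \<open>f = t w\<close>; now \<open>t w0 = f k = 0\<close>,
    so \<open>t\<close> factors through \<open>\<Sigma>u\<close>, which annihilates
    \<open>w\<close>.\<close>
  have inj: "f = zero_arr T Z B" if f: "f \<in> Hom T Z B" "f \<cdot> k = zero_arr T W B" for f B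
  proof -
    have [simp]: "f \<in> arr T" "Dom T f = Z" "Cod T f = B" "B \<in> obj T" using f by (auto simp: Hom_iff)
    have "f \<cdot> v = (f \<cdot> k) \<cdot> v0" using k(2) by simp
    also have "\<dots> = zero_arr T Y B" by (simp only: f(2)) simp
    finally obtain t where t: "t \<in> Hom T (shift_obj T X) B" "f = t \<cdot> w" using ex2[OF f(1)] by blast
    have "t \<cdot> w0 = f \<cdot> k" using t k(3) by (simp add: Hom_iff)
    then have "t \<cdot> w0 = zero_arr T W B" by (simp add: f(2))
    from exact_factor3[OF e t(1) this]
    obtain s where "s \<in> Hom T (shift_obj T Y) B" "t = s \<cdot> shift_arr T u" .
    then show ?thesis using t by (simp add: Hom_iff)
  qed
  \<comment> \<open>A first approximation to the inverse of \<open>k\<close>: it is right after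
    composition with \<open>v0\<close>. The error \<open>1 - g k\<close> therefore factors as
    \<open>t w0 = t w k\<close>, and adding \<open>t w\<close> to \<open>g\<close> corrects
    it.\<close>
  obtain g where g: "g \<in> Hom T Z W" "v0 = g \<cdot> v" using ex1[of v0 W] by (auto simp: Hom_iff)
  have [simp]: "g \<in> arr T" "Dom T g = Z" "Cod T g = W" using g(1) by (simp_all add: Hom_iff)
  have "(ident T W \<boxplus> neg T (g \<cdot> k)) \<cdot> v0 = zero_arr T Y W"
    by (simp add: k(2) g(2)[symmetric])
  from exact_factor2[OF e _ this] obtain t where t: "t \<in> Hom T (shift_obj T X) W" "ident T W \<boxplus> neg T (g \<cdot> k) = t \<cdot> w0"
    by (auto simp: Hom_iff)
  have [simp]: "t \<in> arr T" "Dom T t = shift_obj T X" "Cod T t = W" using t(1) by (simp_all add: Hom_iff)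
  define l where "l = g \<boxplus> t \<cdot> w"
  have [simp]: "l \<in> arr T" "Dom T l = Z" "Cod T l = W" by (simp_all add: l_def)
  have "l \<cdot> k = g \<cdot> k \<boxplus> t \<cdot> w0" using k(3) by (simp add: l_def)
  also have "\<dots> = g \<cdot> k \<boxplus> (ident T W \<boxplus> neg T (g \<cdot> k))" by (simp add: t(2))
  also have "\<dots> = ident T W" by (simp add: plus_left_commute[of "g \<cdot> k"])
  finally have lk: "l \<cdot> k = ident T W" .
  \<comment> \<open>From \<open>l k = 1\<close> the map \<open>k l - 1\<close> vanishes after
    composition with \<open>k\<close>, hence is zero because \<open>k\<close> is epi.\<close>
  have "k \<cdot> l \<boxplus> neg T (ident T Z) \<in> Hom T Z Z" by (simp add: Hom_iff)
  moreover have "(k \<cdot> l \<boxplus> neg T (ident T Z)) \<cdot> k = k \<cdot> (l \<cdot> k) \<boxplus> neg T k" by simp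
  ultimately have "k \<cdot> l \<boxplus> neg T (ident T Z) = zero_arr T Z Z"
    using inj by (simp add: lk)
  then have kl: "k \<cdot> l = ident T Z" using eq_if_plus_neg_zero[of "k \<cdot> l" "ident T Z"] by simp
  have "iso_arrow T k" by (rule iso_arrowI[of k W Z l]) (simp_all add: Hom_iff lk kl)
  then show ?thesis
    by (intro TR1_iso[OF e, of X Y Z u v w "ident T X" "ident T Y" k])
      (use k c in \<open>simp_all add: candidate_triangle_def iso_arrow_ident Hom_iff\<close>)
qed

text \<open>Extending \<open>(i1, i2)\<close> by TR3 to a map \<open>k\<close> from the cone of
  \<open>u\<close> and following it by \<open>p3\<close> gives a comparison map. The factorizations
  are inherited from the large triangle: compose the given map with a retraction \<open>p2\<close>
  or \<open>p3\<close>, factor it there, and restrict along the inclusions. A complementary triangle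
  is never formed.\<close>

lemma exact_retract:
  assumes e: "exact_triangle T X' Y' Z' u' v' w'" and c: "candidate_triangle T X Y Z u v w"
    and m: "triangle_map T (i1, i2, i3) (u, v, w) (u', v', w')"
    and n: "triangle_map T (p1, p2, p3) (u', v', w') (u, v, w)"
    and pi: "p1 \<cdot> i1 = ident T X" "p2 \<cdot> i2 = ident T Y" "p3 \<cdot> i3 = ident T Z"
  shows "exact_triangle T X Y Z u v w"
proof -
  note [simp] = exact_triangleD[OF e]
  note c' = c[unfolded candidate_triangle_def triangle_diagram_def Hom_iff]
  have [simp]: "X \<in> obj T" "Y \<in> obj T" "Z \<in> obj T"
    using c' Dom_obj[of u] Cod_obj[of u] Cod_obj[of v] by simp_all
  have [simp]: "u \<in> arr T" "Dom T u = X" "Cod T u = Y" "v \<in> arr T" "Dom T v = Y" "Cod T v = Z"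
    "w \<in> arr T" "Dom T w = Z" "Cod T w = shift_obj T X" using c' by simp_all
  have [simp]: "i1 \<in> arr T" "Dom T i1 = X" "Cod T i1 = X'" "i2 \<in> arr T" "Dom T i2 = Y" "Cod T i2 = Y'"
    "i3 \<in> arr T" "Dom T i3 = Z" "Cod T i3 = Z'" using m by (simp_all add: Hom_iff)
  have [simp]: "p1 \<in> arr T" "Dom T p1 = X'" "Cod T p1 = X" "p2 \<in> arr T" "Dom T p2 = Y'" "Cod T p2 = Y"
    "p3 \<in> arr T" "Dom T p3 = Z'" "Cod T p3 = Z" using n by (simp_all add: Hom_iff)
  have mi: "i2 \<cdot> u = u' \<cdot> i1" "i3 \<cdot> v = v' \<cdot> i2" "shift_arr T i1 \<cdot> w = w' \<cdot> i3" using m by simp_all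
  have mp: "p2 \<cdot> u' = u \<cdot> p1" "p3 \<cdot> v' = v \<cdot> p2" "shift_arr T p1 \<cdot> w' = w \<cdot> p3" using n by simp_all
  have spi: "shift_arr T p1 \<cdot> shift_arr T i1 = ident T (shift_obj T X)"
    using shift_compose_eq[OF pi(1)] by simp
  have "u \<in> Hom T X Y" by (simp add: Hom_iff)
  then obtain W v0 w0 where e0: "exact_triangle T X Y W u v0 w0" using TR1_cone by blast
  note [simp] = exact_triangleD[OF e0]
  obtain k where k: "triangle_map T (i1, i2, k) (u, v0, w0) (u', v', w')"
    using TR3[OF e0 e, of i1 i2] mi(1) by (auto simp: Hom_iff)
  have [simp]: "k \<in> arr T" "Dom T k = W" "Cod T k = Z'" using k by (simp_all add: Hom_iff)
  have k1: "k \<cdot> v0 = v' \<cdot> i2" "shift_arr T i1 \<cdot> w0 = w' \<cdot> k" using k by simp_all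
  show ?thesis
  proof (rule exact_if_comparison[OF e0 c])
    show "p3 \<cdot> k \<in> Hom T W Z" by (simp add: Hom_iff)
    show "(p3 \<cdot> k) \<cdot> v0 = v"
      by (simp add: k1 compose_rewrite[OF mp(2)] pi)
    show "w \<cdot> (p3 \<cdot> k) = w0"
      by (simp add: compose_rewrite[OF mp(3)[symmetric]] k1(2)[symmetric] compose_rewrite[OF spi])
  next
    fix B f assume f: "f \<in> Hom T Y B" "f \<cdot> u = zero_arr T X B"
    have [simp]: "f \<in> arr T" "Dom T f = Y" "Cod T f = B" "B \<in> obj T" using f(1) by (auto simp: Hom_iff)
    have "(f \<cdot> p2) \<cdot> u' = zero_arr T X' B"
      by (simp add: mp compose_rewrite[OF f(2)])
    then obtain g where g: "g \<in> Hom T Z' B" "f \<cdot> p2 = g \<cdot> v'"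
      using exact_factor1[OF e, of "f \<cdot> p2" B] by (auto simp: Hom_iff)
    then have [simp]: "g \<in> arr T" "Dom T g = Z'" "Cod T g = B" by (simp_all add: Hom_iff)
    have "f = (f \<cdot> p2) \<cdot> i2" by (simp add: pi)
    also have "\<dots> = (g \<cdot> i3) \<cdot> v" by (simp only: g(2)) (simp add: mi)
    finally have "f = (g \<cdot> i3) \<cdot> v" .
    moreover have "g \<cdot> i3 \<in> Hom T Z B" by (simp add: Hom_iff)
    ultimately show "\<exists>g \<in> Hom T Z B. f = g \<cdot> v" by blast
  next
    fix B f assume f: "f \<in> Hom T Z B" "f \<cdot> v = zero_arr T Y B"
    have [simp]: "f \<in> arr T" "Dom T f = Z" "Cod T f = B" "B \<in> obj T" using f(1) by (auto simp: Hom_iff)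
    have "(f \<cdot> p3) \<cdot> v' = zero_arr T Y' B"
      by (simp add: mp compose_rewrite[OF f(2)])
    then obtain g where g: "g \<in> Hom T (shift_obj T X') B" "f \<cdot> p3 = g \<cdot> w'"
      using exact_factor2[OF e, of "f \<cdot> p3" B] by (auto simp: Hom_iff)
    then have [simp]: "g \<in> arr T" "Dom T g = shift_obj T X'" "Cod T g = B" by (simp_all add: Hom_iff)
    have "f = (f \<cdot> p3) \<cdot> i3" by (simp add: pi)
    also have "\<dots> = (g \<cdot> shift_arr T i1) \<cdot> w" by (simp only: g(2)) (simp add: mi)
    finally have "f = (g \<cdot> shift_arr T i1) \<cdot> w" .
    moreover have "g \<cdot> shift_arr T i1 \<in> Hom T (shift_obj T X) B" by (simp add: Hom_iff)
    ultimately show "\<exists>g \<in> Hom T (shift_obj T X) B. f = g \<cdot> w" by blast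
  qed
qed

text \<open>The sum with \<open>A = A \<rightarrow> 0\<close>, the zero summand being absorbed into
  \<open>Z\<close>. In pasting it provides the triangle on the second factor of the octahedron. TR3
  along the projections \<open>p\<close>, \<open>p'\<close> gives the comparison map.\<close>

lemma exact_sum_ident:
  assumes e: "exact_triangle T X Y Z u v w"
    and P: "biprod P X A i j p q" and Q: "biprod Q Y A i' j' p' q'"
  shows "exact_triangle T P Q Z (i' \<cdot> (u \<cdot> p) \<boxplus> j' \<cdot> q) (v \<cdot> p') (shift_arr T i \<cdot> w)"
proof -
  note [simp] = exact_triangleD[OF e] biprodD[OF P] biprodD[OF Q]
  let ?u = "i' \<cdot> (u \<cdot> p) \<boxplus> j' \<cdot> q"
  have sp: "shift_arr T p \<cdot> shift_arr T i = ident T (shift_obj T X)"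
    "shift_arr T q \<cdot> shift_arr T i = zero_arr T (shift_obj T X) (shift_obj T A)"
    by (simp_all add: shift_compose_eq[of p i "ident T X"] shift_compose_eq[of q i "zero_arr T X A"])
  have "?u \<in> Hom T P Q" by (simp add: Hom_iff)
  then obtain W v0 w0 where e0: "exact_triangle T P Q W ?u v0 w0" using TR1_cone by blast
  note e0D = exact_triangleD[OF e0]
  note [simp] = e0D(3,7-12)
  have c: "candidate_triangle T P Q Z ?u (v \<cdot> p') (shift_arr T i \<cdot> w)"
    unfolding candidate_triangle_def triangle_diagram_def
    by (simp add: Hom_iff compose_rewrite[OF sp(1)] compose_rewrite[OF sp(2)])
  obtain k where k: "triangle_map T (p, p', k) (?u, v0, w0) (u, v, w)"
    using TR3[OF e0 e, of p p'] by (auto simp: Hom_iff)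
  have [simp]: "k \<in> arr T" "Dom T k = W" "Cod T k = Z" using k by (simp_all add: Hom_iff)
  have k1: "k \<cdot> v0 = v \<cdot> p'" "shift_arr T p \<cdot> w0 = w \<cdot> k" using k by simp_all
  \<comment> \<open>Since \<open>q' \<cdot> ?u = q\<close>, the vanishing of
    \<open>(\<Sigma>?u) w0\<close> says that \<open>w0\<close> has no component in
    \<open>\<Sigma>A\<close>; its other component is \<open>w k\<close>.\<close>
  have "shift_arr T (q' \<cdot> ?u) \<cdot> w0 = zero_arr T W (shift_obj T A)"
    by (subst shift_compose) (simp_all add: e0D(15) del: shift_plus shift_compose)
  then have k2: "shift_arr T q \<cdot> w0 = zero_arr T W (shift_obj T A)" by simp
  have sum: "shift_arr T i \<cdot> shift_arr T p \<boxplus> shift_arr T j \<cdot> shift_arr T q = ident T (shift_obj T P)"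
    using arg_cong[OF biprod_sum[OF P], of "shift_arr T"] by simp
  show ?thesis
  proof (rule exact_if_comparison[OF e0 c])
    show "k \<in> Hom T W Z" by (simp add: Hom_iff)
    show "k \<cdot> v0 = v \<cdot> p'" by (rule k1)
    have "w0 = (shift_arr T i \<cdot> shift_arr T p \<boxplus> shift_arr T j \<cdot> shift_arr T q) \<cdot> w0"
      by (simp only: sum) simp
    also have "\<dots> = (shift_arr T i \<cdot> w) \<cdot> k" by (simp add: k1 k2)
    finally show "(shift_arr T i \<cdot> w) \<cdot> k = w0" ..
  next
    fix B f assume f: "f \<in> Hom T Q B" "f \<cdot> ?u = zero_arr T P B"
    have [simp]: "f \<in> arr T" "Dom T f = Q" "Cod T f = B" "B \<in> obj T" using f(1) by (auto simp: Hom_iff)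
    have f': "f \<cdot> (?u \<cdot> x) = zero_arr T (Dom T x) B" if "x \<in> arr T" "Cod T x = P" for x
      using compose_rewrite[OF f(2)] that by simp
    have "(f \<cdot> i') \<cdot> u = zero_arr T X B" using f'[of i] by simp
    then obtain g where g: "g \<in> Hom T Z B" "f \<cdot> i' = g \<cdot> v"
      using exact_factor1[OF e, of "f \<cdot> i'" B] by (auto simp: Hom_iff)
    have [simp]: "g \<in> arr T" "Dom T g = Z" "Cod T g = B" using g(1) by (simp_all add: Hom_iff)
    have "f \<cdot> j' = zero_arr T A B" using f'[of j] by simp
    then have "f = g \<cdot> (v \<cdot> p')" by (intro biprod_eq_from[OF Q, of f "g \<cdot> (v \<cdot> p')"]) (simp_all add: g(2))
    then show "\<exists>g \<in> Hom T Z B. f = g \<cdot> (v \<cdot> p')" using g(1) by blast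
  next
    fix B f assume f: "f \<in> Hom T Z B" "f \<cdot> (v \<cdot> p') = zero_arr T Q B"
    have [simp]: "f \<in> arr T" "Dom T f = Z" "Cod T f = B" "B \<in> obj T" using f(1) by (auto simp: Hom_iff)
    have "f \<cdot> v = (f \<cdot> (v \<cdot> p')) \<cdot> i'" by simp
    also have "\<dots> = zero_arr T Y B" by (simp only: f(2)) simp
    finally obtain g where g: "g \<in> Hom T (shift_obj T X) B" "f = g \<cdot> w"
      using exact_factor2[OF e f(1)] by blast
    have [simp]: "g \<in> arr T" "Dom T g = shift_obj T X" "Cod T g = B" using g(1) by (simp_all add: Hom_iff)
    have "f = (g \<cdot> shift_arr T p) \<cdot> (shift_arr T i \<cdot> w)" by (simp add: compose_rewrite[OF sp(1)] g(2))
    moreover have "g \<cdot> shift_arr T p \<in> Hom T (shift_obj T P) B" by (simp add: Hom_iff)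
    ultimately show "\<exists>g \<in> Hom T (shift_obj T P) B. f = g \<cdot> (shift_arr T i \<cdot> w)" by blast
  qed
qed

text \<open>The sum with \<open>0 \<rightarrow> A = A\<close>, which yields the octahedral axiom's
  triangle on a composite landing in one summand. TR3 gives the \<open>Z\<close>-component of the
  comparison map; its \<open>A\<close>-component \<open>l\<close> exists because
  \<open>q \<cdot> (i \<cdot> u) = 0\<close>.\<close>

lemma exact_sum_target:
  assumes e: "exact_triangle T X Y Z u v w"
    and P: "biprod P Y A i j p q" and Q: "biprod Q Z A i' j' p' q'"
  shows "exact_triangle T X P Q (i \<cdot> u) (i' \<cdot> (v \<cdot> p) \<boxplus> j' \<cdot> q) (w \<cdot> p')"
proof -
  note [simp] = exact_triangleD[OF e] biprodD[OF P] biprodD[OF Q]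
  let ?v = "i' \<cdot> (v \<cdot> p) \<boxplus> j' \<cdot> q"
  have "i \<cdot> u \<in> Hom T X P" by (simp add: Hom_iff)
  then obtain W v0 w0 where e0: "exact_triangle T X P W (i \<cdot> u) v0 w0" using TR1_cone by blast
  note e0D = exact_triangleD[OF e0]
  note [simp] = e0D(3,7-12)
  have c: "candidate_triangle T X P Q (i \<cdot> u) ?v (w \<cdot> p')"
    unfolding candidate_triangle_def triangle_diagram_def by (simp add: Hom_iff)
  obtain k where k: "triangle_map T (ident T X, p, k) (i \<cdot> u, v0, w0) (u, v, w)"
    using TR3[OF e0 e, of "ident T X" p] by (auto simp: Hom_iff)
  have [simp]: "k \<in> arr T" "Dom T k = W" "Cod T k = Z" using k by (simp_all add: Hom_iff)
  have k1: "k \<cdot> v0 = v \<cdot> p" "w \<cdot> k = w0" using k by simp_all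
  obtain l where l: "l \<in> Hom T W A" "q = l \<cdot> v0"
    using exact_factor1[OF e0, of q A] by (auto simp: Hom_iff)
  have [simp]: "l \<in> arr T" "Dom T l = W" "Cod T l = A" using l(1) by (simp_all add: Hom_iff)
  show ?thesis
  proof (rule exact_if_comparison[OF e0 c])
    show "i' \<cdot> k \<boxplus> j' \<cdot> l \<in> Hom T W Q" by (simp add: Hom_iff)
    show "(i' \<cdot> k \<boxplus> j' \<cdot> l) \<cdot> v0 = ?v" by (simp add: k1 l(2)[symmetric])
    show "(w \<cdot> p') \<cdot> (i' \<cdot> k \<boxplus> j' \<cdot> l) = w0" by (simp add: k1)
  next
    fix B f assume f: "f \<in> Hom T P B" "f \<cdot> (i \<cdot> u) = zero_arr T X B"
    have [simp]: "f \<in> arr T" "Dom T f = P" "Cod T f = B" "B \<in> obj T" using f(1) by (auto simp: Hom_iff)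
    obtain g where g: "g \<in> Hom T Z B" "f \<cdot> i = g \<cdot> v"
      using exact_factor1[OF e, of "f \<cdot> i" B] f(2) by (auto simp: Hom_iff)
    have [simp]: "g \<in> arr T" "Dom T g = Z" "Cod T g = B" using g(1) by (simp_all add: Hom_iff)
    \<comment> \<open>The restriction of \<open>f\<close> to \<open>Y\<close> is factored through
      \<open>v\<close> as \<open>g\<close>; the restriction to \<open>A\<close> passes unchanged, as
      \<open>?v\<close> is the identity there.\<close>
    have "f = (g \<cdot> p' \<boxplus> f \<cdot> (j \<cdot> q')) \<cdot> ?v"
      by (rule biprod_eq_from[OF P]) (simp_all add: g(2))
    moreover have "g \<cdot> p' \<boxplus> f \<cdot> (j \<cdot> q') \<in> Hom T Q B" by (simp add: Hom_iff)
    ultimately show "\<exists>g \<in> Hom T Q B. f = g \<cdot> ?v" by blast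
  next
    fix B f assume f: "f \<in> Hom T Q B" "f \<cdot> ?v = zero_arr T P B"
    have [simp]: "f \<in> arr T" "Dom T f = Q" "Cod T f = B" "B \<in> obj T" using f(1) by (auto simp: Hom_iff)
    have f': "f \<cdot> (?v \<cdot> x) = zero_arr T (Dom T x) B" if "x \<in> arr T" "Cod T x = P" for x
      using compose_rewrite[OF f(2)] that by simp
    have "(f \<cdot> i') \<cdot> v = zero_arr T Y B" using f'[of i] by simp
    then obtain g where g: "g \<in> Hom T (shift_obj T X) B" "f \<cdot> i' = g \<cdot> w"
      using exact_factor2[OF e, of "f \<cdot> i'" B] by (auto simp: Hom_iff)
    have [simp]: "g \<in> arr T" "Dom T g = shift_obj T X" "Cod T g = B" using g(1) by (simp_all add: Hom_iff)
    have "f \<cdot> j' = zero_arr T A B" using f'[of j] by simp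
    then have "f = g \<cdot> (w \<cdot> p')" by (intro biprod_eq_from[OF Q, of f "g \<cdot> (w \<cdot> p')"]) (simp_all add: g(2))
    then show "\<exists>g \<in> Hom T (shift_obj T X) B. f = g \<cdot> (w \<cdot> p')" using g(1) by blast
  qed
qed


text \<open>The octahedral axiom puts \<open>E\<close>, the biproduct of \<open>V\<close> with \<open>E\<close>, and \<open>D\<close> into an exact triangle; its
  first map becomes split mono with identity component on \<open>E\<close> after a shear, so the remaining
  component \<open>V \<rightarrow> D\<close> of the second map is invertible.\<close>

lemma octahedron_split:
  assumes ef: "exact_triangle T P\<^sub>0 P\<^sub>1 E f f' f''"
    and ec: "exact_triangle T P\<^sub>0 R V c k \<omega>"
    and eg: "exact_triangle T P\<^sub>1 Q D g g' g''"
    and Q: "biprod Q R E i j p q"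
    and gf: "g \<cdot> f = i \<cdot> c" and qg: "q \<cdot> g = f'"
  shows "\<exists>\<beta> \<alpha>. \<beta> \<in> Hom T V D \<and> iso_arrow T \<beta> \<and> \<alpha> \<in> Hom T E V \<and> \<beta> \<cdot> k = g' \<cdot> i \<and>
    g'' \<cdot> \<beta> = shift_arr T f \<cdot> \<omega> \<and> \<omega> \<cdot> \<alpha> = f'' \<and> \<beta> \<cdot> \<alpha> = neg T (g' \<cdot> j)"
proof -
  note [simp] = exact_triangleD[OF ef] exact_triangleD[OF ec] exact_triangleD[OF eg] biprodD[OF Q]
  define S where "S = bisum T V E"
  define i' j' p' q' where "i' = in1 T V E" and "j' = in2 T V E" and "p' = pr1 T V E" and "q' = pr2 T V E"
  have S: "biprod S V E i' j' p' q'"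
    unfolding S_def i'_def j'_def p'_def q'_def by (rule biprod_bisum) simp_all
  note [simp] = biprodD[OF S]
  let ?k = "i' \<cdot> (k \<cdot> p) \<boxplus> j' \<cdot> q"
  have "exact_triangle T P\<^sub>0 Q S (g \<cdot> f) ?k (\<omega> \<cdot> p')"
    using exact_sum_target[OF ec Q S] gf by simp
  from TR4[OF ef eg this] obtain a b where
    eab: "exact_triangle T E S D a b (shift_arr T f' \<cdot> g'')"
    and af: "a \<cdot> f' = ?k \<cdot> g" and wa: "(\<omega> \<cdot> p') \<cdot> a = f''"
    and bk: "b \<cdot> ?k = g'" and gb: "g'' \<cdot> b = shift_arr T f \<cdot> (\<omega> \<cdot> p')" by blast
  note eabD = exact_triangleD[OF eab]
  note [simp] = eabD(4-9,13)
  have wa' [simp]: "\<omega> \<cdot> (p' \<cdot> a) = f''" using wa by simp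
  \<comment> \<open>The \<open>E\<close>-component of \<open>a\<close> is the identity only on the
    image of \<open>f'\<close>; elsewhere it is off by some \<open>t f''\<close>. Because
    \<open>f'' = \<omega> p' a\<close>, this error depends on the \<open>V\<close>-component of
    \<open>a\<close> alone, which is what makes a shear possible.\<close>
  have "(q' \<cdot> a \<boxplus> neg T (ident T E)) \<cdot> f' = zero_arr T P\<^sub>1 E" by (simp add: af qg)
  then obtain t where t: "t \<in> Hom T (shift_obj T P\<^sub>0) E" "q' \<cdot> a \<boxplus> neg T (ident T E) = t \<cdot> f''"
    using exact_factor2[OF ef, of "q' \<cdot> a \<boxplus> neg T (ident T E)" E] by (auto simp: Hom_iff)
  have [simp]: "t \<in> arr T" "Dom T t = shift_obj T P\<^sub>0" "Cod T t = E" using t(1) by (simp_all add: Hom_iff)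
  have "q' \<cdot> a = ident T E \<boxplus> (q' \<cdot> a \<boxplus> neg T (ident T E))"
    using plus_left_commute[of "ident T E" "q' \<cdot> a" "neg T (ident T E)"] by simp
  then have qa: "q' \<cdot> a = ident T E \<boxplus> t \<cdot> f''" by (simp only: t(2))
  \<comment> \<open>Coordinates of \<open>S\<close> sheared by \<open>t \<omega>\<close>: the
    inclusions are \<open>\<sigma>\<close> and \<open>j'\<close>, the projections \<open>p'\<close>
    and \<open>e\<close>. In them \<open>a\<close> has the identity as its
    \<open>E\<close>-component, so \<open>e\<close> splits \<open>a\<close>, and \<open>r\<close>
    projects onto \<open>V\<close> along \<open>a\<close>.\<close>
  define \<sigma> where "\<sigma> = i' \<boxplus> j' \<cdot> (t \<cdot> \<omega>)"
  define e where "e = q' \<boxplus> neg T (t \<cdot> (\<omega> \<cdot> p'))"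
  define r where "r = p' \<boxplus> neg T ((p' \<cdot> a) \<cdot> e)"
  have [simp]: "\<sigma> \<in> arr T" "Dom T \<sigma> = V" "Cod T \<sigma> = S" by (simp_all add: \<sigma>_def)
  have [simp]: "e \<in> arr T" "Dom T e = S" "Cod T e = E" by (simp_all add: e_def)
  have [simp]: "r \<in> arr T" "Dom T r = S" "Cod T r = V" by (simp_all add: r_def)
  have ea: "e \<cdot> a = ident T E" by (simp add: e_def qa)
  have e\<sigma>: "e \<cdot> \<sigma> = zero_arr T V E" by (simp add: e_def \<sigma>_def)
  have ra: "r \<cdot> a = zero_arr T E V" by (simp add: r_def ea)
  have r\<sigma>: "r \<cdot> \<sigma> = ident T V" by (simp add: r_def e\<sigma>) (simp add: \<sigma>_def)
  have \<sigma>e: "\<sigma> \<cdot> p' \<boxplus> j' \<cdot> e = ident T S"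
    by (rule biprod_eq_from[OF S]) (simp_all add: \<sigma>_def e_def)
  have \<sigma>a: "j' \<boxplus> \<sigma> \<cdot> (p' \<cdot> a) = a"
    by (rule biprod_eq_to[OF S]) (simp_all add: \<sigma>_def qa)
  obtain \<rho> where \<rho>: "\<rho> \<in> Hom T D V" "r = \<rho> \<cdot> b"
    using exact_factor1[OF eab, of r V] ra by (auto simp: Hom_iff)
  have [simp]: "\<rho> \<in> arr T" "Dom T \<rho> = D" "Cod T \<rho> = V" using \<rho>(1) by (simp_all add: Hom_iff)
  define \<beta> where "\<beta> = b \<cdot> \<sigma>"
  have [simp]: "\<beta> \<in> arr T" "Dom T \<beta> = V" "Cod T \<beta> = D" by (simp_all add: \<beta>_def)
  have \<rho>\<beta>: "\<rho> \<cdot> \<beta> = ident T V"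
    using r\<sigma> by (simp add: \<beta>_def \<rho>(2))
  \<comment> \<open>Expanding \<open>b a = 0\<close> in the sheared coordinates. This produces the
    sign in the last conclusion, since \<open>b j' = g' j\<close>.\<close>
  have "b \<cdot> (j' \<boxplus> \<sigma> \<cdot> (p' \<cdot> a)) = zero_arr T E D" by (simp only: \<sigma>a) simp
  then have "b \<cdot> j' \<boxplus> \<beta> \<cdot> (p' \<cdot> a) = zero_arr T E D" by (simp add: \<beta>_def)
  then have bj: "b \<cdot> j' = neg T (\<beta> \<cdot> (p' \<cdot> a))"
    by (intro eq_if_plus_neg_zero[of "b \<cdot> j'" "neg T (\<beta> \<cdot> (p' \<cdot> a))"]) simp_all
  have "b = b \<cdot> (\<sigma> \<cdot> p' \<boxplus> j' \<cdot> e)" by (simp only: \<sigma>e) simp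
  also have "\<dots> = \<beta> \<cdot> p' \<boxplus> (b \<cdot> j') \<cdot> e" by (simp add: \<beta>_def)
  also have "\<dots> = \<beta> \<cdot> r" by (simp only: bj) (simp add: r_def)
  finally have b: "b = \<beta> \<cdot> (\<rho> \<cdot> b)" by (simp only: \<rho>(2))
  \<comment> \<open>The map \<open>\<beta> \<rho> - 1\<close> kills \<open>b\<close>, so it factors
    through the third map of the triangle. That map is annihilated by \<open>\<Sigma>a\<close>,
    which has the left inverse \<open>\<Sigma>e\<close>, hence it is zero.\<close>
  have "(\<beta> \<cdot> \<rho> \<boxplus> neg T (ident T D)) \<cdot> b = \<beta> \<cdot> (\<rho> \<cdot> b) \<boxplus> neg T b" by simp
  also have "\<dots> = zero_arr T S D" by (simp only: b[symmetric]) simp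
  finally obtain s where s: "s \<in> Hom T (shift_obj T E) D"
    "\<beta> \<cdot> \<rho> \<boxplus> neg T (ident T D) = s \<cdot> (shift_arr T f' \<cdot> g'')"
    using exact_factor2[OF eab, of "\<beta> \<cdot> \<rho> \<boxplus> neg T (ident T D)" D] by (auto simp: Hom_iff)
  have "shift_arr T f' \<cdot> g'' = (shift_arr T e \<cdot> shift_arr T a) \<cdot> (shift_arr T f' \<cdot> g'')"
    by (simp only: shift_compose_eq[OF ea] \<open>e \<in> arr T\<close> \<open>Dom T e = S\<close> eabD(4,6)) simp
  also have "\<dots> = zero_arr T D (shift_obj T E)"
    using eabD(15) by simp
  finally have "\<beta> \<cdot> \<rho> \<boxplus> neg T (ident T D) = zero_arr T D D"
    using s by (simp add: Hom_iff)
  then have \<beta>\<rho>: "\<beta> \<cdot> \<rho> = ident T D" using eq_if_plus_neg_zero[of "\<beta> \<cdot> \<rho>" "ident T D"] by simp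
  have iso: "iso_arrow T \<beta>"
    by (rule iso_arrowI[of \<beta> V D \<rho>]) (simp_all add: Hom_iff \<rho>\<beta> \<beta>\<rho>)
  have bk': "b \<cdot> (?k \<cdot> x) = g' \<cdot> x" if "x \<in> arr T" "Cod T x = Q" for x
    using compose_rewrite[OF bk] that by simp
  have gb': "g'' \<cdot> (b \<cdot> x) = shift_arr T f \<cdot> (\<omega> \<cdot> (p' \<cdot> x))" if "x \<in> arr T" "Cod T x = S" for x
    using compose_rewrite[OF gb] that by simp
  have "\<beta> \<cdot> k = g' \<cdot> i" using bk'[of i] by (simp add: \<beta>_def \<sigma>_def)
  moreover have "g'' \<cdot> \<beta> = shift_arr T f \<cdot> \<omega>" by (simp add: \<beta>_def gb' del: compose_plus) (simp add: \<sigma>_def)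
  moreover have "\<beta> \<cdot> (p' \<cdot> a) = neg T (g' \<cdot> j)" using bk'[of j] bj neg_neg[of "\<beta> \<cdot> (p' \<cdot> a)"] by simp
  ultimately show ?thesis
    using iso by (intro exI[of _ \<beta>] exI[of _ "p' \<cdot> a"]) (simp add: Hom_iff)
qed

section \<open>Homotopy cartesian squares\<close>

text \<open>The mapping cone of \<open>(1, g, h)\<close> is this triangle plus the contractible triangle on the identity of
  \<open>\<Sigma>X\<close>.\<close>

lemma good_map_imp_square_exact:
  assumes e: "exact_triangle T X Y Z u v w" and e': "exact_triangle T X Y' Z' u' v' w'"
    and good: "good_map T (ident T X, g, h) (u, v, w) (u', v', w')"
  shows "exact_triangle T Y (bisum T Y' Z) Z' (col_mat T g v) (row_mat T v' (neg T h)) (shift_arr T u \<cdot> w')"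
proof -
  note [simp] = exact_triangleD[OF e] exact_triangleD[OF e']
  have m: "triangle_map T (ident T X, g, h) (u, v, w) (u', v', w')"
    and cone: "mapping_cone T (ident T X, g, h) (u, v, w) (u', v', w') \<in> distinguished T"
    using good unfolding good_map_def by blast+
  have [simp]: "g \<in> arr T" "Dom T g = Y" "Cod T g = Y'" "h \<in> arr T" "Dom T h = Z" "Cod T h = Z'"
    and gu: "g \<cdot> u = u'" and hv: "h \<cdot> v = v' \<cdot> g"
    using m by (simp_all add: Hom_iff)
  have "w' \<cdot> h = shift_arr T (ident T X) \<cdot> w" using m unfolding triangle_map.simps by metis
  then have wh: "w' \<cdot> h = w" by simp
  note [simp] = gu hv wh compose_rewrite[OF gu] compose_rewrite[OF hv] compose_rewrite[OF wh]
  have [simp]: "shift_arr T g \<cdot> (shift_arr T u \<cdot> x) = shift_arr T u' \<cdot> x"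
    "shift_arr T v \<cdot> (shift_arr T u \<cdot> x) = zero_arr T (Dom T x) (shift_obj T Z)"
    if "x \<in> arr T" "Cod T x = shift_obj T X" for x
    using that by (simp_all add: compose_rewrite[OF shift_compose_eq[OF gu]]
        compose_rewrite[OF shift_compose_eq[of v u "zero_arr T X Z"]])
  define m1 m2 m3 where "m1 = mat22 T u' g (zero_arr T X Z) (neg T v)"
    and "m2 = mat22 T v' h (zero_arr T Y' (shift_obj T X)) (neg T w)"
    and "m3 = shift_bisum T X Y \<cdot> mat22 T w' (ident T (shift_obj T X))
      (zero_arr T Z' (shift_obj T Y)) (neg T (shift_arr T u))"
  have M1: "m1 = in1 T Y' Z \<cdot> (u' \<cdot> pr1 T X Y) \<boxplus>
      (in1 T Y' Z \<cdot> (g \<cdot> pr2 T X Y) \<boxplus> neg T (in2 T Y' Z \<cdot> (v \<cdot> pr2 T X Y)))"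
    by (simp add: m1_def mat22_def col_mat_def row_mat_def)
  have M2: "m2 = in1 T Z' (shift_obj T X) \<cdot> (v' \<cdot> pr1 T Y' Z) \<boxplus>
      (in1 T Z' (shift_obj T X) \<cdot> (h \<cdot> pr2 T Y' Z) \<boxplus> neg T (in2 T Z' (shift_obj T X) \<cdot> (w \<cdot> pr2 T Y' Z)))"
    by (simp add: m2_def mat22_def col_mat_def row_mat_def)
  have M3: "m3 = shift_arr T (in1 T X Y) \<cdot> (w' \<cdot> pr1 T Z' (shift_obj T X)) \<boxplus>
      (shift_arr T (in1 T X Y) \<cdot> pr2 T Z' (shift_obj T X) \<boxplus>
       neg T (shift_arr T (in2 T X Y) \<cdot> (shift_arr T u \<cdot> pr2 T Z' (shift_obj T X))))"
    by (simp add: m3_def mat22_def shift_bisum_def col_mat_def row_mat_def)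
  have "(m1, m2, m3) \<in> distinguished T" using cone by (simp add: m1_def m2_def m3_def)
  from distinguished_candidate[OF this] this
  have econe: "exact_triangle T (bisum T X Y) (bisum T Y' Z) (bisum T Z' (shift_obj T X)) m1 m2 m3"
    by (simp add: exact_triangle_def M1 M2)
  have C: "col_mat T g v = in1 T Y' Z \<cdot> g \<boxplus> in2 T Y' Z \<cdot> v" by (simp add: col_mat_def)
  have R: "row_mat T v' (neg T h) = v' \<cdot> pr1 T Y' Z \<boxplus> neg T (h \<cdot> pr2 T Y' Z)" by (simp add: row_mat_def)
  \<comment> \<open>The cone carries \<open>(g, -v)\<close> and \<open>(v', h)\<close> where the
    square carries \<open>(g, v)\<close> and \<open>(v', -h)\<close>; \<open>s\<close> flips the
    sign on \<open>Z\<close> to match them.\<close>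
  define s where "s = in1 T Y' Z \<cdot> pr1 T Y' Z \<boxplus> neg T (in2 T Y' Z \<cdot> pr2 T Y' Z)"
  have sh: "shift_arr T (pr1 T X Y) \<cdot> (shift_arr T (in1 T X Y) \<cdot> x) = x"
    "shift_arr T (pr2 T X Y) \<cdot> (shift_arr T (in1 T X Y) \<cdot> x) = zero_arr T (Dom T x) (shift_obj T Y)"
    if "x \<in> arr T" "Cod T x = shift_obj T X" for x
    using that by (simp_all add: compose_rewrite[OF shift_compose_eq[of "pr1 T X Y" "in1 T X Y" "ident T X"]]
        compose_rewrite[OF shift_compose_eq[of "pr2 T X Y" "in1 T X Y" "zero_arr T X Y"]])
  have sh': "shift_arr T (pr1 T X Y) \<cdot> (shift_arr T (in2 T X Y) \<cdot> x) = zero_arr T (Dom T x) (shift_obj T X)"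
    "shift_arr T (pr2 T X Y) \<cdot> (shift_arr T (in2 T X Y) \<cdot> x) = x"
    if "x \<in> arr T" "Cod T x = shift_obj T Y" for x
    using that by (simp_all add: compose_rewrite[OF shift_compose_eq[of "pr1 T X Y" "in2 T X Y" "zero_arr T Y X"]]
        compose_rewrite[OF shift_compose_eq[of "pr2 T X Y" "in2 T X Y" "ident T Y"]])
  show ?thesis unfolding C R
  proof (rule exact_retract[OF econe])
    show "candidate_triangle T Y (bisum T Y' Z) Z' (in1 T Y' Z \<cdot> g \<boxplus> in2 T Y' Z \<cdot> v)
        (v' \<cdot> pr1 T Y' Z \<boxplus> neg T (h \<cdot> pr2 T Y' Z)) (shift_arr T u \<cdot> w')"
      by (simp add: candidate_triangle_def triangle_diagram_def Hom_iff)
    \<comment> \<open>The square is included as a graph in the third term: the component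
      \<open>-w'\<close> in \<open>\<Sigma>X\<close> cancels the part of \<open>m3\<close> in
      \<open>\<Sigma>X\<close>, leaving \<open>(\<Sigma>u) w'\<close> in
      \<open>\<Sigma>Y\<close>.\<close>
    show "triangle_map T (in2 T X Y, s, in1 T Z' (shift_obj T X) \<boxplus> neg T (in2 T Z' (shift_obj T X) \<cdot> w'))
      (in1 T Y' Z \<cdot> g \<boxplus> in2 T Y' Z \<cdot> v, v' \<cdot> pr1 T Y' Z \<boxplus> neg T (h \<cdot> pr2 T Y' Z), shift_arr T u \<cdot> w')
      (m1, m2, m3)"
      unfolding triangle_map.simps
    proof (intro conjI)
      show "s \<cdot> (in1 T Y' Z \<cdot> g \<boxplus> in2 T Y' Z \<cdot> v) = m1 \<cdot> in2 T X Y"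
        by (simp add: M1 s_def)
      show "(in1 T Z' (shift_obj T X) \<boxplus> neg T (in2 T Z' (shift_obj T X) \<cdot> w')) \<cdot>
          (v' \<cdot> pr1 T Y' Z \<boxplus> neg T (h \<cdot> pr2 T Y' Z)) = m2 \<cdot> s"
        by (rule bisum_eq_from[of Y' Z]) (simp_all add: M2 s_def)
      show "shift_arr T (in2 T X Y) \<cdot> (shift_arr T u \<cdot> w') =
          m3 \<cdot> (in1 T Z' (shift_obj T X) \<boxplus> neg T (in2 T Z' (shift_obj T X) \<cdot> w'))"
        by (simp add: M3)
    qed (simp_all add: Hom_iff M1 M2 M3 s_def)
    \<comment> \<open>The retraction sends \<open>X\<close> to \<open>Y\<close> by \<open>u\<close>,
      as forced by \<open>u' = g u\<close> and \<open>v u = 0\<close> in the first column of the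
      cone.\<close>
    show "triangle_map T (u \<cdot> pr1 T X Y \<boxplus> pr2 T X Y, s, pr1 T Z' (shift_obj T X)) (m1, m2, m3)
      (in1 T Y' Z \<cdot> g \<boxplus> in2 T Y' Z \<cdot> v, v' \<cdot> pr1 T Y' Z \<boxplus> neg T (h \<cdot> pr2 T Y' Z), shift_arr T u \<cdot> w')"
      unfolding triangle_map.simps
    proof (intro conjI)
      show "s \<cdot> m1 = (in1 T Y' Z \<cdot> g \<boxplus> in2 T Y' Z \<cdot> v) \<cdot> (u \<cdot> pr1 T X Y \<boxplus> pr2 T X Y)"
        by (rule bisum_eq_from[of X Y]) (simp_all add: M1 s_def)
      show "pr1 T Z' (shift_obj T X) \<cdot> m2 = (v' \<cdot> pr1 T Y' Z \<boxplus> neg T (h \<cdot> pr2 T Y' Z)) \<cdot> s"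
        by (rule bisum_eq_from[of Y' Z]) (simp_all add: M2 s_def)
      show "shift_arr T (u \<cdot> pr1 T X Y \<boxplus> pr2 T X Y) \<cdot> m3 = (shift_arr T u \<cdot> w') \<cdot> pr1 T Z' (shift_obj T X)"
        by (simp add: M3 sh sh')
    qed (simp_all add: Hom_iff M1 M2 M3 s_def)
    show "(u \<cdot> pr1 T X Y \<boxplus> pr2 T X Y) \<cdot> in2 T X Y = ident T Y" by simp
    show "s \<cdot> s = ident T (bisum T Y' Z)"
      by (rule bisum_eq_from[of Y' Z]) (simp_all add: s_def)
    show "pr1 T Z' (shift_obj T X) \<cdot> (in1 T Z' (shift_obj T X) \<boxplus> neg T (in2 T Z' (shift_obj T X) \<cdot> w')) =
        ident T Z'" by simp
  qed
qed


text \<open>The octahedron on \<open>u\<close> followed by the column \<open>(g, v)\<close>: as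
  \<open>v u = 0\<close>, the composite is \<open>u'\<close> in the summand \<open>Y'\<close>, and
  the projection to \<open>Z\<close> gives back \<open>v\<close>. The cone of the column is thereby
  identified with \<open>Z'\<close>, its differential becomes \<open>(\<Sigma>u) w'\<close>, and the
  map between the cones of \<open>u\<close> and \<open>u'\<close> is \<open>h\<close>, with the sign
  seen in the row.\<close>

lemma exact_square_completion:
  assumes e: "exact_triangle T X Y Z u v w" and e': "exact_triangle T X Y' Z' u' v' w'"
    and g: "g \<in> Hom T Y Y'" "g \<cdot> u = u'"
  shows "\<exists>h \<in> Hom T Z Z'. w' \<cdot> h = w \<and>
    exact_triangle T Y (bisum T Y' Z) Z' (col_mat T g v) (row_mat T v' (neg T h)) (shift_arr T u \<cdot> w')"
proof -
  note [simp] = exact_triangleD[OF e] exact_triangleD[OF e']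
  have [simp]: "g \<in> arr T" "Dom T g = Y" "Cod T g = Y'" using g(1) by (simp_all add: Hom_iff)
  have C: "col_mat T g v = in1 T Y' Z \<cdot> g \<boxplus> in2 T Y' Z \<cdot> v" by (simp add: col_mat_def)
  have "col_mat T g v \<in> Hom T Y (bisum T Y' Z)" by (simp add: C Hom_iff)
  then obtain W k \<omega> where eW: "exact_triangle T Y (bisum T Y' Z) W (col_mat T g v) k \<omega>"
    using TR1_cone by blast
  note eWD = exact_triangleD[OF eW]
  note [simp] = eWD(3,7-12)
  have "col_mat T g v \<cdot> u = in1 T Y' Z \<cdot> u'" "pr2 T Y' Z \<cdot> col_mat T g v = v"
    by (simp_all add: C g(2))
  from octahedron_split[OF e e' eW biprod_bisum this] obtain \<beta> h where
    \<beta>: "\<beta> \<in> Hom T Z' W" "iso_arrow T \<beta>" "\<beta> \<cdot> v' = k \<cdot> in1 T Y' Z" "\<omega> \<cdot> \<beta> = shift_arr T u \<cdot> w'"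
    and h: "h \<in> Hom T Z Z'" "w' \<cdot> h = w" "\<beta> \<cdot> h = neg T (k \<cdot> in2 T Y' Z)" by auto
  have [simp]: "\<beta> \<in> arr T" "Dom T \<beta> = Z'" "Cod T \<beta> = W" "h \<in> arr T" "Dom T h = Z" "Cod T h = Z'"
    using \<beta>(1) h(1) by (simp_all add: Hom_iff)
  have R: "row_mat T v' (neg T h) = v' \<cdot> pr1 T Y' Z \<boxplus> neg T (h \<cdot> pr2 T Y' Z)" by (simp add: row_mat_def)
  have "\<beta> \<cdot> row_mat T v' (neg T h) = k"
    by (rule bisum_eq_from[of Y' Z]) (simp_all add: R \<beta>(3) h(3))
  with exact_change3[OF eW \<beta>(2,1) _ this \<beta>(4)] h show ?thesis by (auto simp: Hom_iff R)
qed

text \<open>The octahedron on \<open>(g1, v1)\<close> followed by \<open>(g2, v2) \<oplus> 1\<close>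
  on \<open>Z1\<close>. The composite has components \<open>g2 g1\<close>,
  \<open>v2 g1 = h1 v1\<close> and \<open>v1\<close>, so its \<open>Z2\<close>-component is a
  function of its \<open>Z1\<close>-component and the composite lives on a copy of
  \<open>Y3 \<oplus> Z1\<close>.\<close>

lemma exact_square_paste:
  assumes e1: "exact_triangle T Y1 (bisum T Y2 Z1) Z2 (col_mat T g1 v1) (row_mat T v2 (neg T h1)) d1"
    and e2: "exact_triangle T Y2 (bisum T Y3 Z2) Z3 (col_mat T g2 v2) (row_mat T v3 (neg T h2)) d2"
    and m: "g1 \<in> Hom T Y1 Y2" "v1 \<in> Hom T Y1 Z1" "h1 \<in> Hom T Z1 Z2" "v2 \<in> Hom T Y2 Z2"
      "g2 \<in> Hom T Y2 Y3" "h2 \<in> Hom T Z2 Z3" "v3 \<in> Hom T Y3 Z3"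
  shows "\<exists>d. exact_triangle T Y1 (bisum T Y3 Z1) Z3
    (col_mat T (g2 \<cdot> g1) v1) (row_mat T v3 (neg T (h2 \<cdot> h1))) d"
proof -
  have [simp]: "g1 \<in> arr T" "Dom T g1 = Y1" "Cod T g1 = Y2" "v1 \<in> arr T" "Dom T v1 = Y1" "Cod T v1 = Z1"
    "h1 \<in> arr T" "Dom T h1 = Z1" "Cod T h1 = Z2" "v2 \<in> arr T" "Dom T v2 = Y2" "Cod T v2 = Z2"
    "g2 \<in> arr T" "Dom T g2 = Y2" "Cod T g2 = Y3" "h2 \<in> arr T" "Dom T h2 = Z2" "Cod T h2 = Z3"
    "v3 \<in> arr T" "Dom T v3 = Y3" "Cod T v3 = Z3"
    using m by (simp_all add: Hom_iff)
  have [simp]: "Y1 \<in> obj T" "Y2 \<in> obj T" "Y3 \<in> obj T" "Z1 \<in> obj T" "Z2 \<in> obj T" "Z3 \<in> obj T"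
    using Dom_obj[of g1] Dom_obj[of v2] Dom_obj[of v3] Dom_obj[of h1] Dom_obj[of h2] Cod_obj[of h2]
    by simp_all
  have C1: "col_mat T g1 v1 = in1 T Y2 Z1 \<cdot> g1 \<boxplus> in2 T Y2 Z1 \<cdot> v1"
    and C2: "col_mat T g2 v2 = in1 T Y3 Z2 \<cdot> g2 \<boxplus> in2 T Y3 Z2 \<cdot> v2"
    and C: "col_mat T (g2 \<cdot> g1) v1 = in1 T Y3 Z1 \<cdot> (g2 \<cdot> g1) \<boxplus> in2 T Y3 Z1 \<cdot> v1"
    by (simp_all add: col_mat_def)
  have R1: "row_mat T v2 (neg T h1) = v2 \<cdot> pr1 T Y2 Z1 \<boxplus> neg T (h1 \<cdot> pr2 T Y2 Z1)"
    and R2: "row_mat T v3 (neg T h2) = v3 \<cdot> pr1 T Y3 Z2 \<boxplus> neg T (h2 \<cdot> pr2 T Y3 Z2)"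
    and R: "row_mat T v3 (neg T (h2 \<cdot> h1)) = v3 \<cdot> pr1 T Y3 Z1 \<boxplus> neg T (h2 \<cdot> (h1 \<cdot> pr2 T Y3 Z1))"
    by (simp_all add: row_mat_def)
  have "row_mat T v2 (neg T h1) \<cdot> col_mat T g1 v1 = zero_arr T Y1 Z2" by (rule exact_triangleD(13)[OF e1])
  then have "v2 \<cdot> g1 \<boxplus> neg T (h1 \<cdot> v1) = zero_arr T Y1 Z2" by (simp add: C1 R1)
  then have vg: "v2 \<cdot> g1 = h1 \<cdot> v1" using eq_if_plus_neg_zero[of "v2 \<cdot> g1" "h1 \<cdot> v1"] by simp
  define I Q R' where "I = bisum T Y3 Z2" and "Q = bisum T I Z1" and "R' = bisum T Y3 Z1"
  have [simp]: "I \<in> obj T" "R' \<in> obj T" "Q \<in> obj T" by (simp_all add: I_def R'_def Q_def)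
  have eI: "exact_triangle T Y2 I Z3 (col_mat T g2 v2) (row_mat T v3 (neg T h2)) d2"
    using e2 by (simp add: I_def)
  have bI: "biprod I Y3 Z2 (in1 T Y3 Z2) (in2 T Y3 Z2) (pr1 T Y3 Z2) (pr2 T Y3 Z2)"
    and bQ: "biprod Q I Z1 (in1 T I Z1) (in2 T I Z1) (pr1 T I Z1) (pr2 T I Z1)"
    and bR: "biprod R' Y3 Z1 (in1 T Y3 Z1) (in2 T Y3 Z1) (pr1 T Y3 Z1) (pr2 T Y3 Z1)"
    unfolding I_def Q_def R'_def by (simp_all add: biprod_bisum bisum_obj)
  have [simp]: "bisum T Y3 Z2 = I" "bisum T I Z1 = Q" "bisum T Y3 Z1 = R'"
    by (simp_all add: I_def Q_def R'_def)
  \<comment> \<open>The inclusion \<open>(y, z) \<mapsto> (y, h1 z, z)\<close> is the graph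
    containing the composite. The complementary projection \<open>?q\<close> measures the distance
    \<open>z2 - h1 z1\<close> from it, so \<open>?q \<cdot> ?g\<close> is the row
    \<open>(v2, -h1)\<close> of the first square.\<close>
  let ?i = "in1 T I Z1 \<cdot> (in1 T Y3 Z2 \<cdot> pr1 T Y3 Z1 \<boxplus> in2 T Y3 Z2 \<cdot> (h1 \<cdot> pr2 T Y3 Z1)) \<boxplus>
    in2 T I Z1 \<cdot> pr2 T Y3 Z1"
  let ?j = "in1 T I Z1 \<cdot> in2 T Y3 Z2"
  let ?p = "in1 T Y3 Z1 \<cdot> (pr1 T Y3 Z2 \<cdot> pr1 T I Z1) \<boxplus> in2 T Y3 Z1 \<cdot> pr2 T I Z1"
  let ?q = "pr2 T Y3 Z2 \<cdot> pr1 T I Z1 \<boxplus> neg T (h1 \<cdot> pr2 T I Z1)"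
  have b: "biprod Q R' Z2 ?i ?j ?p ?q"
    unfolding biprod_def
  proof (intro conjI)
    show "?p \<cdot> ?i = ident T R'" by (rule biprod_eq_to[OF bR]) simp_all
    show "?i \<cdot> ?p \<boxplus> ?j \<cdot> ?q = ident T Q"
    proof (rule biprod_eq_to[OF bQ])
      show "pr1 T I Z1 \<cdot> (?i \<cdot> ?p \<boxplus> ?j \<cdot> ?q) = pr1 T I Z1 \<cdot> ident T Q"
        by (rule biprod_eq_to[OF bI]) (simp_all add: plus_left_commute[of "h1 \<cdot> pr2 T I Z1" "pr2 T Y3 Z2 \<cdot> pr1 T I Z1"])
    qed simp_all
    show "?p \<cdot> ?j = zero_arr T Z2 R'" by simp
    show "?q \<cdot> ?i = zero_arr T R' Z2" by simp
    show "?q \<cdot> ?j = ident T Z2" by simp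
  qed (simp_all add: Hom_iff)
  let ?g = "in1 T I Z1 \<cdot> (col_mat T g2 v2 \<cdot> pr1 T Y2 Z1) \<boxplus> in2 T I Z1 \<cdot> pr2 T Y2 Z1"
  have eg: "exact_triangle T (bisum T Y2 Z1) Q Z3 ?g (row_mat T v3 (neg T h2) \<cdot> pr1 T I Z1)
      (shift_arr T (in1 T Y2 Z1) \<cdot> d2)"
    by (rule exact_sum_ident[OF eI biprod_bisum bQ]) simp_all
  have "col_mat T (g2 \<cdot> g1) v1 \<in> Hom T Y1 R'" by (simp add: C Hom_iff)
  then obtain W k \<omega> where eW: "exact_triangle T Y1 R' W (col_mat T (g2 \<cdot> g1) v1) k \<omega>"
    using TR1_cone by blast
  note eWD = exact_triangleD[OF eW]
  note [simp] = eWD(3,7-12)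
  have 1: "?g \<cdot> col_mat T g1 v1 = ?i \<cdot> col_mat T (g2 \<cdot> g1) v1"
    by (simp add: C1 C2 C vg)
  have 2: "?q \<cdot> ?g = row_mat T v2 (neg T h1)"
    by (rule bisum_eq_from[of Y2 Z1]) (simp_all add: R1 C2)
  obtain \<beta> where \<beta>: "\<beta> \<in> Hom T W Z3" "iso_arrow T \<beta>"
    "\<beta> \<cdot> k = (row_mat T v3 (neg T h2) \<cdot> pr1 T I Z1) \<cdot> ?i"
    using octahedron_split[OF e1 eW eg b 1 2] by blast
  have [simp]: "\<beta> \<in> arr T" "Dom T \<beta> = W" "Cod T \<beta> = Z3" using \<beta>(1) by (simp_all add: Hom_iff)
  have \<beta>k: "\<beta> \<cdot> k = row_mat T v3 (neg T (h2 \<cdot> h1))"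
    unfolding \<beta>(3) by (simp add: R2 R)
  obtain \<gamma> where \<gamma>: "\<gamma> \<in> Hom T Z3 W" "\<gamma> \<cdot> \<beta> = ident T W" "\<beta> \<cdot> \<gamma> = ident T Z3"
    using iso_arrowE[OF \<beta>(2,1)] .
  have i\<gamma>: "iso_arrow T \<gamma>" using iso_arrowI[OF \<gamma>(1) \<beta>(1) \<gamma>(3,2)] .
  have [simp]: "\<gamma> \<in> arr T" "Dom T \<gamma> = Z3" "Cod T \<gamma> = W" using \<gamma>(1) by (simp_all add: Hom_iff)
  have "\<gamma> \<cdot> row_mat T v3 (neg T (h2 \<cdot> h1)) = (\<gamma> \<cdot> \<beta>) \<cdot> k" by (simp add: \<beta>k)
  also have "\<dots> = k" by (simp only: \<gamma>(2)) simp
  finally have \<gamma>k: "\<gamma> \<cdot> row_mat T v3 (neg T (h2 \<cdot> h1)) = k" .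
  have "row_mat T v3 (neg T (h2 \<cdot> h1)) \<in> Hom T R' Z3" by (simp add: R Hom_iff)
  \<comment> \<open>The pasted differential is \<open>\<omega> \<gamma>\<close>, where
    \<open>\<omega>\<close> came with the cone that TR1 supplied.\<close>
  from exact_change3[OF eW i\<gamma> \<gamma>(1) this \<gamma>k refl] show ?thesis by auto
qed

end

section \<open>The composite map and the three replacements\<close>

theorem corollary6p14:
  fixes T :: "('o, 'm, 'x) triangulated_data_scheme" (structure)
    and X Y1 Y2 Y3 Z1 Z2 Z3 :: 'o
    and u1 v1 w1 u2 v2 w2 u3 v3 w3 g1 h1 g2 h2 :: 'm
  assumes "triangulated_category T"
    and "exact_triangle T X Y1 Z1 u1 v1 w1"
    and "exact_triangle T X Y2 Z2 u2 v2 w2"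
    and "exact_triangle T X Y3 Z3 u3 v3 w3"
    and "good_map T (ident T X, g1, h1) (u1, v1, w1) (u2, v2, w2)"
    and "good_map T (ident T X, g2, h2) (u2, v2, w2) (u3, v3, w3)"
  shows "replaceably_exact T Y1 (bisum T Y3 Z1) Z3
           (col_mat T (g2 \<cdot> g1) v1)
           (row_mat T v3 (neg T (h2 \<cdot> h1)))
           (shift_arr T u1 \<cdot> w3)"
proof -
  interpret triangulated_category T by (rule assms(1))
  note e1 = assms(2) and e2 = assms(3) and e3 = assms(4)
  note [simp] = exact_triangleD[OF e1] exact_triangleD[OF e2] exact_triangleD[OF e3]
  have m1: "triangle_map T (ident T X, g1, h1) (u1, v1, w1) (u2, v2, w2)"
    and m2: "triangle_map T (ident T X, g2, h2) (u2, v2, w2) (u3, v3, w3)"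
    using assms(5,6) unfolding good_map_def by blast+
  have [simp]: "g1 \<in> arr T" "Dom T g1 = Y1" "Cod T g1 = Y2" "h1 \<in> arr T" "Dom T h1 = Z1" "Cod T h1 = Z2"
    and gu1: "g1 \<cdot> u1 = u2" and hv1: "h1 \<cdot> v1 = v2 \<cdot> g1"
    using m1 by (simp_all add: Hom_iff)
  have [simp]: "g2 \<in> arr T" "Dom T g2 = Y2" "Cod T g2 = Y3" "h2 \<in> arr T" "Dom T h2 = Z2" "Cod T h2 = Z3"
    and gu2: "g2 \<cdot> u2 = u3" and hv2: "h2 \<cdot> v2 = v3 \<cdot> g2"
    using m2 by (simp_all add: Hom_iff)
  have "w2 \<cdot> h1 = shift_arr T (ident T X) \<cdot> w1" "w3 \<cdot> h2 = shift_arr T (ident T X) \<cdot> w2"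
    using m1 m2 unfolding triangle_map.simps by metis+
  then have wh1: "w2 \<cdot> h1 = w1" and wh2: "w3 \<cdot> h2 = w2" by simp_all
  define g h where "g = g2 \<cdot> g1" and "h = h2 \<cdot> h1"
  have [simp]: "g \<in> arr T" "Dom T g = Y1" "Cod T g = Y3" "h \<in> arr T" "Dom T h = Z1" "Cod T h = Z3"
    by (simp_all add: g_def h_def)
  have gu: "g \<cdot> u1 = u3" by (simp add: g_def gu1 gu2)
  have hv: "h \<cdot> v1 = v3 \<cdot> g" by (simp add: g_def h_def hv1 compose_rewrite[OF hv2])
  have wh: "w3 \<cdot> h = w1" by (simp add: h_def compose_rewrite[OF wh2] wh1)
  have C: "col_mat T g v1 = in1 T Y3 Z1 \<cdot> g \<boxplus> in2 T Y3 Z1 \<cdot> v1" by (simp add: col_mat_def)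
  have R: "row_mat T v3 (neg T x) = v3 \<cdot> pr1 T Y3 Z1 \<boxplus> neg T (x \<cdot> pr2 T Y3 Z1)"
    if "x \<in> Hom T Z1 Z3" for x using that by (simp add: row_mat_def Hom_iff)
  have hH: "h \<in> Hom T Z1 Z3" by (simp add: Hom_iff)
  \<comment> \<open>The first composite is \<open>(\<Sigma>u3) w3\<close>, by
    \<open>g u1 = u3\<close>; the second vanishes by \<open>v1 u1 = 0\<close>.\<close>
  have "shift_arr T g \<cdot> (shift_arr T u1 \<cdot> w3) = zero_arr T Z3 (shift_obj T Y3)"
    "shift_arr T v1 \<cdot> (shift_arr T u1 \<cdot> w3) = zero_arr T Z3 (shift_obj T Z1)"
    by (simp_all add: compose_rewrite[OF shift_compose_eq[OF gu]]
        compose_rewrite[OF shift_compose_eq[of v1 u1 "zero_arr T X Z1"]])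
  then have cand: "candidate_triangle T Y1 (bisum T Y3 Z1) Z3 (col_mat T g v1) (row_mat T v3 (neg T h))
      (shift_arr T u1 \<cdot> w3)"
    unfolding candidate_triangle_def triangle_diagram_def C R[OF hH]
    by (simp add: Hom_iff hv compose_rewrite[OF wh])
  obtain h' where h': "h' \<in> Hom T Z1 Z3" "w3 \<cdot> h' = w1"
    and ex: "exact_triangle T Y1 (bisum T Y3 Z1) Z3 (col_mat T g v1) (row_mat T v3 (neg T h'))
      (shift_arr T u1 \<cdot> w3)"
    using exact_square_completion[OF e1 e3 _ gu] by (auto simp: Hom_iff)
  have [simp]: "h' \<in> arr T" "Dom T h' = Z1" "Cod T h' = Z3" using h'(1) by (simp_all add: Hom_iff)
  have "w3 \<cdot> (h \<boxplus> neg T h') = zero_arr T Z1 (shift_obj T X)" by (simp add: wh h'(2))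
  then obtain t where t: "t \<in> Hom T Z1 Y3" "h \<boxplus> neg T h' = v3 \<cdot> t"
    using exact_lift[OF e3, of "h \<boxplus> neg T h'" Z1] by (auto simp: Hom_iff)
  have [simp]: "t \<in> arr T" "Dom T t = Z1" "Cod T t = Y3" using t(1) by (simp_all add: Hom_iff)
  have "h = h' \<boxplus> (h \<boxplus> neg T h')" using plus_left_commute[of h' h "neg T h'"] by simp
  then have h: "h = h' \<boxplus> v3 \<cdot> t" by (simp only: t(2))
  \<comment> \<open>The shear \<open>(y, z) \<mapsto> (y + t z, z)\<close> of \<open>Y3 \<oplus> Z1\<close> trades \<open>h'\<close> for \<open>h\<close> and \<open>g\<close> for \<open>g + t v1\<close>.\<close>
  define \<kappa> \<kappa>' where "\<kappa> = ident T (bisum T Y3 Z1) \<boxplus> in1 T Y3 Z1 \<cdot> (t \<cdot> pr2 T Y3 Z1)"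
    and "\<kappa>' = ident T (bisum T Y3 Z1) \<boxplus> neg T (in1 T Y3 Z1 \<cdot> (t \<cdot> pr2 T Y3 Z1))"
  have \<kappa>: "\<kappa> \<in> Hom T (bisum T Y3 Z1) (bisum T Y3 Z1)" "\<kappa>' \<in> Hom T (bisum T Y3 Z1) (bisum T Y3 Z1)"
    by (simp_all add: \<kappa>_def \<kappa>'_def Hom_iff)
  have "\<kappa>' \<cdot> \<kappa> = ident T (bisum T Y3 Z1)" "\<kappa> \<cdot> \<kappa>' = ident T (bisum T Y3 Z1)"
    by (simp_all add: \<kappa>_def \<kappa>'_def)
  then have "iso_arrow T \<kappa>" using iso_arrowI[OF \<kappa>] by blast
  moreover have "row_mat T v3 (neg T h) \<cdot> \<kappa> = row_mat T v3 (neg T h')"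
    unfolding R[OF hH] R[OF h'(1)]
    by (rule bisum_eq_from[of Y3 Z1]) (simp_all add: \<kappa>_def h)
  moreover have "row_mat T v3 (neg T h) \<in> Hom T (bisum T Y3 Z1) Z3"
    by (simp add: R[OF hH] Hom_iff)
  ultimately have "exact_triangle T Y1 (bisum T Y3 Z1) Z3 (\<kappa> \<cdot> col_mat T g v1) (row_mat T v3 (neg T h))
      (shift_arr T u1 \<cdot> w3)"
    using exact_change2[OF ex _ \<kappa>(1)] by blast
  \<comment> \<open>Goodness of each of the two maps enters only here, through the two squares to be
    pasted.\<close>
  moreover obtain d where
    "exact_triangle T Y1 (bisum T Y3 Z1) Z3 (col_mat T g v1) (row_mat T v3 (neg T h)) d"
    using exact_square_paste[OF good_map_imp_square_exact[OF e1 e2 assms(5)]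
        good_map_imp_square_exact[OF e2 e3 assms(6)]] by (auto simp: Hom_iff g_def h_def)
  ultimately show ?thesis
    using cand ex unfolding replaceably_exact_def replaceable1_def replaceable2_def replaceable3_def
      g_def h_def by blast
qed

end
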